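(* Let $K$ be a field, let $G$ be a 3-star like tree with vertex set $[n]=\{1,\dots,n\}$, let $S=K[x_1,\dots,x_n,y_1,\dots,y_n]$, and let $J_G\subset S$ be the binomial edge ideal of $G$. (1) If $G$ is of the first type (so $n>3$), then $$H(S/J_G,t)=\frac{(1+2t-2t^{3})(1+t)^{n-4}}{(1-t)^{n+2}}.$$ (2) If $G$ is of the second type (so $n>5$), then $$H(S/J_G,t)=\frac{(1+4t+5t^{2}-3t^{4})(1+t)^{n-6}}{(1-t)^{n+2}}.$$
   Context: All graphs are finite, simple and undirected; a tree is a connected graph without cycles. The binomial edge ideal $J_G\subset S$ is the ideal generated by all $x_iy_j-x_jy_i$ with $1\le i<j\le n$ and $\{i,j\}$ an edge of $G$. The ring $S$ has the standard grading (all variables in degree 1), and $H(N,t)=\sum_i\dim_K(N_i)\,t^i$ denotes the Hilbert series of a finitely generated graded $S$-module $N$. The 3-star like trees which are not paths are of two types. First type: a tree with no vertex of degree $\ge 4$ and exactly one vertex of degree 3. Second type: a tree with no vertex of degree $\ge 4$ and exactly two vertices of degree 3, these two vertices being adjacent. *)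

theory Defs
  imports
    "HOL-Library.Poly_Mapping"
    "HOL-Algebra.QuotRing"
    "HOL-Algebra.Embedded_Algebras"
    "HOL-Computational_Algebra.Formal_Power_Series"
begin

section \<open>Graphs\<close>

text \<open>A graph is a vertex set together with a set of edges, an edge being a two-element set
  of vertices.\<close>

definition simple_graph :: "'a set \<Rightarrow> 'a set set \<Rightarrow> bool" where
  "simple_graph V E \<longleftrightarrow> finite V \<and> (\<forall>e\<in>E. \<exists>u\<in>V. \<exists>v\<in>V. u \<noteq> v \<and> e = {u, v})"

definition vertex_degree :: "'a set set \<Rightarrow> 'a \<Rightarrow> nat" where
  "vertex_degree E v = card {e \<in> E. v \<in> e}"

definition connected_graph :: "'a set \<Rightarrow> 'a set set \<Rightarrow> bool" where
  "connected_graph V E \<longleftrightarrow> V \<noteq> {} \<and> (\<forall>u\<in>V. \<forall>v\<in>V. (u, v) \<in> {(a, b). {a, b} \<in> E}\<^sup>*)"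

text \<open>The list holds the pairwise distinct vertices of the cycle in cyclic order, the first
  vertex not being repeated at the end.\<close>

definition graph_cycle :: "'a set set \<Rightarrow> 'a list \<Rightarrow> bool" where
  "graph_cycle E c \<longleftrightarrow> length c \<ge> 3 \<and> distinct c \<and>
     (\<forall>i<length c. {c ! i, c ! (Suc i mod length c)} \<in> E)"

definition tree_graph :: "'a set \<Rightarrow> 'a set set \<Rightarrow> bool" where
  "tree_graph V E \<longleftrightarrow> simple_graph V E \<and> connected_graph V E \<and> (\<nexists>c. graph_cycle E c)"

definition three_star_like_first :: "'a set \<Rightarrow> 'a set set \<Rightarrow> bool" where
  "three_star_like_first V E \<longleftrightarrow> tree_graph V E \<and>
     (\<forall>v\<in>V. \<not> vertex_degree E v \<ge> 4) \<and>
     card {v \<in> V. vertex_degree E v = 3} = 1"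

definition three_star_like_second :: "'a set \<Rightarrow> 'a set set \<Rightarrow> bool" where
  "three_star_like_second V E \<longleftrightarrow> tree_graph V E \<and>
     (\<forall>v\<in>V. \<not> vertex_degree E v \<ge> 4) \<and>
     (\<exists>u v. u \<noteq> v \<and> {w \<in> V. vertex_degree E w = 3} = {u, v} \<and> {u, v} \<in> E)"

section \<open>The polynomial ring\<close>

datatype pvar = XVar nat | YVar nat

text \<open>A monomial is a finitely supported exponent function on the variables, and a polynomial a
  finitely supported coefficient function on the monomials; multiplication of polynomials in
  \<^theory>\<open>HOL-Library.Poly_Mapping\<close> is convolution. The type has infinitely many variables; the
  ring of polynomials in \<open>x\<^sub>1, \<dots>, x\<^sub>n, y\<^sub>1, \<dots>, y\<^sub>n\<close> is cut out by its carrier.\<close>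

type_synonym monom = "pvar \<Rightarrow>\<^sub>0 nat"
type_synonym 'k mpol = "monom \<Rightarrow>\<^sub>0 'k"

definition xvar :: "nat \<Rightarrow> 'k::field mpol" where
  "xvar i = Poly_Mapping.single (Poly_Mapping.single (XVar i) 1) 1"

definition yvar :: "nat \<Rightarrow> 'k::field mpol" where
  "yvar i = Poly_Mapping.single (Poly_Mapping.single (YVar i) 1) 1"

definition const_pol :: "'k::field \<Rightarrow> 'k mpol" where
  "const_pol c = Poly_Mapping.single 0 c"

definition pol_carrier :: "nat \<Rightarrow> 'k::field mpol set" where
  "pol_carrier n =
     {p. \<forall>m \<in> Poly_Mapping.keys p. Poly_Mapping.keys m \<subseteq> XVar ` {1..n} \<union> YVar ` {1..n}}"

definition pol_ring :: "nat \<Rightarrow> 'k::field mpol ring" where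
  "pol_ring n = \<lparr>carrier = pol_carrier n, monoid.mult = (*), one = 1, zero = 0, add = (+)\<rparr>"

definition monom_deg :: "monom \<Rightarrow> nat" where
  "monom_deg m = (\<Sum>v\<in>Poly_Mapping.keys m. Poly_Mapping.lookup m v)"

definition homogeneous_part :: "nat \<Rightarrow> nat \<Rightarrow> 'k::field mpol set" where
  "homogeneous_part n d = {p \<in> pol_carrier n. \<forall>m \<in> Poly_Mapping.keys p. monom_deg m = d}"

section \<open>Binomial edge ideals and Hilbert series\<close>

definition binomial_edge_ideal :: "nat \<Rightarrow> nat set set \<Rightarrow> 'k::field mpol set" where
  "binomial_edge_ideal n E = genideal (pol_ring n)
     {xvar i * yvar j - xvar j * yvar i |i j. 1 \<le> i \<and> i < j \<and> j \<le> n \<and> {i, j} \<in> E}"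

text \<open>For a homogeneous ideal \<open>J\<close> of \<open>S\<close>, the quotient \<open>S/J\<close> is graded by the images of the
  homogeneous parts of \<open>S\<close>. For a proper ideal \<open>J\<close> the images of the constants form a subfield of
  \<open>S/J\<close> isomorphic to \<open>K\<close>, and dimensions are taken over this subfield.\<close>

definition quot_map :: "nat \<Rightarrow> 'k::field mpol set \<Rightarrow> 'k mpol \<Rightarrow> 'k mpol set" where
  "quot_map n J p = J +>\<^bsub>pol_ring n\<^esub> p"

definition quot_hilbert_series :: "nat \<Rightarrow> 'k::field mpol set \<Rightarrow> rat fps" where
  "quot_hilbert_series n J = Abs_fps (\<lambda>d. of_nat
     (ring.dim (pol_ring n Quot J) (quot_map n J ` range const_pol)
        (quot_map n J ` homogeneous_part n d)))"

section \<open>Well-definedness\<close>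

lemma pol_carrier_simps:
  "(0::'k::field mpol) \<in> pol_carrier n" "(1::'k mpol) \<in> pol_carrier n"
  by (auto simp: pol_carrier_def)

lemma pol_carrier_add:
  "p \<in> pol_carrier n \<Longrightarrow> q \<in> pol_carrier n \<Longrightarrow> p + q \<in> pol_carrier n"
  unfolding pol_carrier_def using Poly_Mapping.keys_add[of p q] by blast

lemma pol_carrier_uminus:
  "p \<in> pol_carrier n \<Longrightarrow> - p \<in> pol_carrier n"
  by (simp add: pol_carrier_def)

lemma pol_carrier_mult:
  assumes "p \<in> pol_carrier n" "q \<in> pol_carrier n"
  shows "p * q \<in> pol_carrier n"
  unfolding pol_carrier_def
proof safe
  fix m v
  assume m: "m \<in> Poly_Mapping.keys (p * q)" and v: "v \<in> Poly_Mapping.keys m"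
    and "v \<notin> YVar ` {1..n}"
  obtain a b where ab: "m = a + b" "a \<in> Poly_Mapping.keys p" "b \<in> Poly_Mapping.keys q"
    using keys_mult[of p q] m by blast
  have "v \<in> Poly_Mapping.keys a \<union> Poly_Mapping.keys b"
    using v ab(1) Poly_Mapping.keys_add[of a b] by blast
  then have "v \<in> XVar ` {1..n} \<union> YVar ` {1..n}"
    using assms ab(2,3) unfolding pol_carrier_def by blast
  with \<open>v \<notin> YVar ` {1..n}\<close> show "v \<in> XVar ` {1..n}"
    by blast
qed

lemma pol_ring_cring: "cring (pol_ring n :: 'k::field mpol ring)"
proof (intro cringI abelian_groupI comm_monoidI)
  fix p :: "'k mpol"
  assume "p \<in> carrier (pol_ring n)"
  then show "\<exists>q\<in>carrier (pol_ring n). q \<oplus>\<^bsub>pol_ring n\<^esub> p = \<zero>\<^bsub>pol_ring n\<^esub>"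
    by (intro bexI[of _ "- p"]) (auto simp: pol_ring_def pol_carrier_uminus)
qed (auto simp: pol_ring_def pol_carrier_simps pol_carrier_add pol_carrier_mult ac_simps
    distrib_left)

lemma binomial_edge_ideal_ideal:
  "ideal (binomial_edge_ideal n E :: 'k::field mpol set) (pol_ring n)"
proof -
  interpret cring "pol_ring n :: 'k mpol ring" by (rule pol_ring_cring)
  have var: "xvar i \<in> (pol_carrier n :: 'k mpol set)" "yvar i \<in> (pol_carrier n :: 'k mpol set)"
    if "1 \<le> i" "i \<le> n" for i
    using that by (auto simp: pol_carrier_def xvar_def yvar_def)
  have "xvar i * yvar j - xvar j * yvar i \<in> (pol_carrier n :: 'k mpol set)"
    if "1 \<le> i" "i < j" "j \<le> n" for i j
  proof -
    have "xvar i * yvar j + - (xvar j * yvar i) \<in> (pol_carrier n :: 'k mpol set)"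
      using that by (intro pol_carrier_add pol_carrier_mult pol_carrier_uminus var) auto
    then show ?thesis by simp
  qed
  then show ?thesis
    unfolding binomial_edge_ideal_def by (intro genideal_ideal) (auto simp: pol_ring_def)
qed

end

theory Submission
  imports Defs
begin

text \<open>Write \<open>f\<^sub>u\<^sub>v = x\<^sub>u y\<^sub>v - x\<^sub>v y\<^sub>u\<close> and \<open>S\<close> for the polynomial ring. For a homogeneous ideal \<open>J\<close> and a
  quadric \<open>f\<close> the exact sequence \<open>0 \<rightarrow> S/(J : f)(-2) \<rightarrow> S/J \<rightarrow> S/(J + (f)) \<rightarrow> 0\<close> gives
  \<open>H(S/(J + (f))) = H(S/J) - t\<^sup>2 H(S/(J : f))\<close>; in particular \<open>f\<close> is a nonzerodivisor modulo
  \<open>J\<close> if and only if \<open>H(S/(J + (f))) = (1 - t\<^sup>2) H(S/J)\<close>. If \<open>x\<^sub>u\<close> is a nonzerodivisor modulo \<open>J\<close> and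
  the variables of \<open>v\<close> do not occur in \<open>J\<close>, then \<open>f\<^sub>u\<^sub>v\<close> is a nonzerodivisor modulo \<open>J\<close> and \<open>x\<^sub>v\<close> is one
  modulo \<open>J + (f\<^sub>u\<^sub>v)\<close>, so paths can be attached edge by edge. Closing a triangle \<open>a u b\<close> multiplies by
  \<open>(1 - t)\<^sup>2 (1 + 2t)\<close>, since the colon ideal of \<open>f\<^sub>a\<^sub>b\<close> is generated by \<open>x\<^sub>u, y\<^sub>u\<close> and the edges avoiding
  \<open>u\<close>. Finally, remove from the tree the edge \<open>u v\<close> at a vertex \<open>u\<close> of degree 3 (joining the two
  vertices of degree 3 for the second type). Two disjoint paths remain, and the colon ideal of
  \<open>f\<^sub>u\<^sub>v\<close> is the binomial edge ideal obtained by joining the two neighbours of \<open>u\<close>, and those of \<open>v\<close> if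
  there are two, to form triangles.\<close>

section \<open>Operations on polynomials\<close>

text \<open>Two obstacles shape the proof. An edge between two finished components is not a leaf, so
  attaching vertices does not show that its binomial is a nonzerodivisor; and a colon ideal is not
  visible from generators. Counting removes the first: the same edge set can be grown in another
  order in which every step attaches something new, and the Hilbert series so obtained, compared
  with the series without the edge, shows that the binomial is a nonzerodivisor. The second then
  becomes easy: if \<open>F0\<close> is contained in \<open>F\<close>, every element of
  \<open>F\<close> lies in the colon ideal of \<open>F0\<close> by \<open>f\<close>, and
  \<open>f\<close> is a nonzerodivisor modulo \<open>F\<close>, then \<open>F\<close> generates that
  colon ideal, because \<open>f * h\<close> in the ideal of \<open>F0\<close> lies in the ideal of
  \<open>F\<close>. The containment of \<open>F\<close> comes from an identity of determinants.
  Growth always continues at a vertex whose x-variable is a nonzerodivisor. Each attachment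
  therefore returns this property for the vertex at which the next one starts, and the triangle
  needs an argument of its own for it.\<close>

lemma mpol_keys_induct [case_names zero add]:
  assumes "P 0"
    and "\<And>m c p. m \<notin> Poly_Mapping.keys p \<Longrightarrow> c \<noteq> 0 \<Longrightarrow> P p \<Longrightarrow> P (Poly_Mapping.single m c + p)"
  shows "P (p :: 'a \<Rightarrow>\<^sub>0 'b::comm_monoid_add)"
proof (induct p rule: Poly_Mapping.update_induct)
  case const
  then show ?case using assms(1) .
next
  case (update f a b)
  then have "Poly_Mapping.update a b f = Poly_Mapping.single a b + f"
    by (intro poly_mapping_eqI)
       (auto simp: lookup_update lookup_add lookup_single when_def in_keys_iff)
  with update assms(2) show ?case by simp
qed

lemma keys_single_add:
  assumes "m \<notin> Poly_Mapping.keys p" "c \<noteq> 0"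
  shows "Poly_Mapping.keys (Poly_Mapping.single m c + p) = insert m (Poly_Mapping.keys p)"
  using assms by (auto simp: in_keys_iff lookup_add lookup_single when_def split: if_splits)

text \<open>Common form of setting a variable to zero (\<open>kill\<close>) and of taking a
  homogeneous component (\<open>hcomp\<close>).\<close>

definition filt :: "('a \<Rightarrow> bool) \<Rightarrow> ('a \<Rightarrow>\<^sub>0 'b::zero) \<Rightarrow> ('a \<Rightarrow>\<^sub>0 'b)" where
  "filt Q p = Abs_poly_mapping (\<lambda>m. Poly_Mapping.lookup p m when Q m)"

lemma lookup_filt: "Poly_Mapping.lookup (filt Q p) m = (Poly_Mapping.lookup p m when Q m)"
proof -
  have "finite {m. (Poly_Mapping.lookup p m when Q m) \<noteq> 0}"
    by (rule finite_subset[OF _ finite_keys[of p]]) (auto simp: in_keys_iff)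
  then show ?thesis by (simp add: filt_def)
qed

lemma keys_filt: "Poly_Mapping.keys (filt Q p) = {m \<in> Poly_Mapping.keys p. Q m}"
  by (auto simp: in_keys_iff lookup_filt)

lemma filt_zero [simp]: "filt Q 0 = 0"
  by (intro poly_mapping_eqI) (simp add: lookup_filt)

lemma filt_add: "filt Q (p + q) = filt Q p + filt Q (q :: 'a \<Rightarrow>\<^sub>0 'b::comm_monoid_add)"
  by (intro poly_mapping_eqI) (simp add: lookup_filt lookup_add when_def)

lemma filt_uminus: "filt Q (- p) = - filt Q (p :: 'a \<Rightarrow>\<^sub>0 'b::ab_group_add)"
  by (intro poly_mapping_eqI) (simp add: lookup_filt when_def)

lemma filt_diff: "filt Q (p - q) = filt Q p - filt Q (q :: 'a \<Rightarrow>\<^sub>0 'b::ab_group_add)"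
  by (intro poly_mapping_eqI) (simp add: lookup_filt lookup_minus when_def)

lemma filt_single: "filt Q (Poly_Mapping.single m c) = (if Q m then Poly_Mapping.single m c else 0)"
  by (intro poly_mapping_eqI) (auto simp: lookup_filt lookup_single when_def)

lemma filt_ident: "(\<And>m. m \<in> Poly_Mapping.keys p \<Longrightarrow> Q m) \<Longrightarrow> filt Q p = p"
  by (intro poly_mapping_eqI) (auto simp: lookup_filt when_def in_keys_iff)

lemma filt_eq_0: "(\<And>m. m \<in> Poly_Mapping.keys p \<Longrightarrow> \<not> Q m) \<Longrightarrow> filt Q p = 0"
  by (intro poly_mapping_eqI) (auto simp: lookup_filt when_def in_keys_iff)

definition mvar :: "pvar \<Rightarrow> 'k::field mpol" where
  "mvar v = Poly_Mapping.single (Poly_Mapping.single v 1) 1"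

lemma xvar_eq: "xvar i = mvar (XVar i)" and yvar_eq: "yvar i = mvar (YVar i)"
  by (simp_all add: xvar_def yvar_def mvar_def)

definition avoids :: "pvar \<Rightarrow> 'k::field mpol \<Rightarrow> bool" where
  "avoids v p \<longleftrightarrow> (\<forall>m\<in>Poly_Mapping.keys p. Poly_Mapping.lookup m v = 0)"

definition kill :: "pvar \<Rightarrow> 'k::field mpol \<Rightarrow> 'k mpol" where
  "kill v = filt (\<lambda>m. Poly_Mapping.lookup m v = 0)"

text \<open>The quotient on division by the variable, the remainder being \<open>kill v p\<close>;
  see \<open>kill_split\<close>. Terms free of \<open>v\<close> are dropped.\<close>

definition shift :: "pvar \<Rightarrow> 'k::field mpol \<Rightarrow> 'k mpol" where
  "shift v p = Abs_poly_mapping (\<lambda>m. Poly_Mapping.lookup p (m + Poly_Mapping.single v 1))"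

definition hcomp :: "nat \<Rightarrow> 'k::field mpol \<Rightarrow> 'k mpol" where
  "hcomp d = filt (\<lambda>m. monom_deg m = d)"

definition is_hom :: "nat \<Rightarrow> 'k::field mpol \<Rightarrow> bool" where
  "is_hom d p \<longleftrightarrow> (\<forall>m\<in>Poly_Mapping.keys p. monom_deg m = d)"

lemma lookup_shift:
  "Poly_Mapping.lookup (shift v p) m = Poly_Mapping.lookup p (m + Poly_Mapping.single v 1)"
proof -
  have "finite ((\<lambda>m. m + Poly_Mapping.single v 1) -` Poly_Mapping.keys p)"
    by (intro finite_vimageI finite_keys) (simp add: inj_on_def)
  then have "finite {m. Poly_Mapping.lookup p (m + Poly_Mapping.single v 1) \<noteq> 0}"
    by (simp add: vimage_def in_keys_iff)
  then show ?thesis by (simp add: shift_def)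
qed

lemma shift_zero [simp]: "shift v 0 = 0"
  by (intro poly_mapping_eqI) (simp add: lookup_shift)

lemma shift_add: "shift v (p + q) = shift v p + shift v q"
  by (intro poly_mapping_eqI) (simp add: lookup_shift lookup_add)

lemma shift_single:
  "shift v (Poly_Mapping.single m c) =
    (if Poly_Mapping.lookup m v = 0 then 0
     else Poly_Mapping.single (m - Poly_Mapping.single v 1) c)"
proof -
  have *: "k + Poly_Mapping.single v 1 \<noteq> m" if "Poly_Mapping.lookup m v = 0" for k
  proof
    assume "k + Poly_Mapping.single v 1 = m"
    then have "Poly_Mapping.lookup (k + Poly_Mapping.single v 1) v = Poly_Mapping.lookup m v" by simp
    with that show False by (simp add: lookup_add)
  qed
  have **: "m - Poly_Mapping.single v 1 + Poly_Mapping.single v 1 = m"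
    if "Poly_Mapping.lookup m v \<noteq> 0"
    using that by (intro poly_mapping_eqI) (auto simp: lookup_add lookup_minus lookup_single when_def)
  have ***: "m = k + Poly_Mapping.single v 1 \<longleftrightarrow> m - Poly_Mapping.single v 1 = k"
    if "Poly_Mapping.lookup m v \<noteq> 0" for k
    using **[OF that] by (metis add_diff_cancel_right')
  show ?thesis
  proof (cases "Poly_Mapping.lookup m v = 0")
    case True
    show ?thesis
      using *[OF True] True
      by (intro poly_mapping_eqI) (simp add: lookup_shift lookup_single when_def eq_commute[of m])
  next
    case False
    show ?thesis
      using ***[OF False] False
      by (intro poly_mapping_eqI) (simp add: lookup_shift lookup_single when_def)
  qed
qed

lemma kill_zero [simp]: "kill v 0 = 0" by (simp add: kill_def)
lemma kill_add: "kill v (p + q) = kill v p + kill v q" by (simp add: kill_def filt_add)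
lemma kill_diff: "kill v (p - q) = kill v p - kill v q" by (simp add: kill_def filt_diff)

lemma kill_uminus: "kill v (- p) = - kill v p" by (simp add: kill_def filt_uminus)

text \<open>Dropping the terms that contain \<open>v\<close> is the substitution of 0 for
  \<open>v\<close>: on monomials, an exponent sum vanishes exactly when both exponents do.\<close>

lemma kill_mult: "kill v (p * q) = kill v p * kill v q"
proof (induct p rule: mpol_keys_induct)
  case (add m c p)
  have "kill v (Poly_Mapping.single m c * q) = kill v (Poly_Mapping.single m c) * kill v q"
    by (induct q rule: mpol_keys_induct)
       (simp_all add: kill_def filt_add distrib_left mult_single filt_single lookup_add)
  with add show ?case by (simp add: distrib_right kill_add)
qed (simp add: kill_def)

lemma kill_split: "p = kill v p + mvar v * shift v p"
proof (induct p rule: mpol_keys_induct)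
  case (add m c p)
  have "Poly_Mapping.single m c
      = kill v (Poly_Mapping.single m c) + mvar v * shift v (Poly_Mapping.single m c)"
  proof (cases "Poly_Mapping.lookup m v = 0")
    case False
    then have "Poly_Mapping.single v 1 + (m - Poly_Mapping.single v 1) = m"
      by (intro poly_mapping_eqI) (auto simp: lookup_add lookup_minus lookup_single when_def)
    with False show ?thesis
      by (simp add: kill_def filt_single shift_single mvar_def mult_single)
  qed (simp add: kill_def filt_single shift_single)
  with add show ?case by (simp add: kill_add shift_add algebra_simps)
qed simp

lemma avoids_0 [simp]: "avoids v 0" by (simp add: avoids_def)

lemma avoids_single_add:
  "m \<notin> Poly_Mapping.keys p \<Longrightarrow> c \<noteq> 0 \<Longrightarrow>
    avoids v (Poly_Mapping.single m c + p) \<longleftrightarrow> Poly_Mapping.lookup m v = 0 \<and> avoids v p"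
  by (simp add: avoids_def keys_single_add)

lemma kill_avoids: "avoids v p \<Longrightarrow> kill v p = p"
  by (auto simp: kill_def avoids_def intro: filt_ident)

lemma avoids_kill: "avoids v (kill v p)"
  by (simp add: avoids_def kill_def keys_filt)

lemma avoids_iff_kill: "avoids v p \<longleftrightarrow> kill v p = p"
  using kill_avoids avoids_kill by metis

lemma avoids_mult: "avoids v p \<Longrightarrow> avoids v q \<Longrightarrow> avoids v (p * q)"
  by (simp add: avoids_iff_kill kill_mult)

lemma avoids_diff: "avoids v p \<Longrightarrow> avoids v q \<Longrightarrow> avoids v (p - q)"
  by (simp add: avoids_iff_kill kill_diff)

lemma kill_mvar: "kill v (mvar w) = (if v = w then 0 else mvar w)"
  by (auto simp: kill_def mvar_def filt_single lookup_single when_def)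

lemma avoids_mvar: "v \<noteq> w \<Longrightarrow> avoids v (mvar w)"
  by (simp add: avoids_iff_kill kill_mvar)

text \<open>A factor free of \<open>v\<close> does not change whether a term is divisible by
  \<open>v\<close>, so division by \<open>v\<close> is linear over such factors.\<close>

lemma shift_mult: "avoids v f \<Longrightarrow> shift v (q * f) = shift v q * f"
proof (induct f rule: mpol_keys_induct)
  case (add m c f)
  then have m: "Poly_Mapping.lookup m v = 0" and f: "avoids v f"
    by (simp_all add: avoids_single_add)
  have "shift v (q * Poly_Mapping.single m c) = shift v q * Poly_Mapping.single m c"
  proof (induct q rule: mpol_keys_induct)
    case (add k b q)
    have "k + m - Poly_Mapping.single v 1 = k - Poly_Mapping.single v 1 + m"
      if "Poly_Mapping.lookup k v \<noteq> 0"
      using that m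
      by (intro poly_mapping_eqI) (auto simp: lookup_add lookup_minus lookup_single when_def)
    then have "shift v (Poly_Mapping.single k b * Poly_Mapping.single m c)
        = shift v (Poly_Mapping.single k b) * Poly_Mapping.single m c"
      using m by (simp add: mult_single shift_single lookup_add)
    with add show ?case by (simp add: distrib_right shift_add)
  qed simp
  with add f show ?case by (simp add: distrib_left shift_add)
qed simp

lemma shift_mvar_mult: "shift v (mvar v * p) = p"
  by (induct p rule: mpol_keys_induct)
     (simp_all add: distrib_left shift_add mvar_def mult_single shift_single lookup_add)

text \<open>Makes induction on the degree in \<open>v\<close> possible without defining that degree:
  the number of divisions serves as the measure.\<close>

lemma funpow_shift_eventually_0: "\<exists>k. (shift v ^^ k) p = 0"
proof -
  have lk: "Poly_Mapping.lookup ((shift v ^^ k) p) m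
      = Poly_Mapping.lookup p (m + Poly_Mapping.single v k)" for k m
  proof (induct k arbitrary: m)
    case (Suc k)
    have "m + Poly_Mapping.single v 1 + Poly_Mapping.single v k = m + Poly_Mapping.single v (Suc k)"
      by (intro poly_mapping_eqI) (simp add: lookup_add lookup_single when_def)
    with Suc show ?case by (simp add: lookup_shift)
  qed simp
  \<comment> \<open>One more than every exponent of \<open>v\<close> in \<open>p\<close>; the
    inserted 0 keeps the maximum meaningful for \<open>p = 0\<close>.\<close>
  define k where "k = Suc (Max (insert 0 ((\<lambda>m. Poly_Mapping.lookup m v) ` Poly_Mapping.keys p)))"
  have "Poly_Mapping.lookup p (m + Poly_Mapping.single v k) = 0" for m
  proof (rule ccontr)
    assume "Poly_Mapping.lookup p (m + Poly_Mapping.single v k) \<noteq> 0"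
    then have "Poly_Mapping.lookup (m + Poly_Mapping.single v k) v
        \<le> Max (insert 0 ((\<lambda>m. Poly_Mapping.lookup m v) ` Poly_Mapping.keys p))"
      by (intro Max_ge) (auto simp: in_keys_iff)
    then show False by (simp add: lookup_add k_def)
  qed
  then have "(shift v ^^ k) p = 0" by (intro poly_mapping_eqI) (simp add: lk)
  then show ?thesis ..
qed

section \<open>Degrees and homogeneous components\<close>

lemma monom_deg_superset:
  "finite A \<Longrightarrow> Poly_Mapping.keys m \<subseteq> A \<Longrightarrow> monom_deg m = (\<Sum>v\<in>A. Poly_Mapping.lookup m v)"
  unfolding monom_deg_def by (intro sum.mono_neutral_left) (auto simp: in_keys_iff)

lemma monom_deg_add: "monom_deg (a + b) = monom_deg a + monom_deg b"
proof -
  let ?A = "Poly_Mapping.keys a \<union> Poly_Mapping.keys b"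
  have "finite ?A" by simp
  then show ?thesis
    using Poly_Mapping.keys_add[of a b]
    by (simp add: monom_deg_superset[of ?A] lookup_add sum.distrib)
qed

lemma monom_deg_single: "monom_deg (Poly_Mapping.single v k) = k"
  by (simp add: monom_deg_def)

lemma hcomp_zero [simp]: "hcomp d 0 = 0" by (simp add: hcomp_def)
lemma hcomp_add: "hcomp d (p + q) = hcomp d p + hcomp d q" by (simp add: hcomp_def filt_add)
lemma is_hom_hcomp: "is_hom d (hcomp d p)" by (simp add: is_hom_def hcomp_def keys_filt)
lemma is_hom_0 [simp]: "is_hom d 0" by (simp add: is_hom_def)

lemma hcomp_is_hom: "is_hom e p \<Longrightarrow> hcomp d p = (if d = e then p else 0)"
  by (auto simp: hcomp_def is_hom_def intro: filt_ident filt_eq_0)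

text \<open>A homogeneous factor only moves the grading. The case distinction guards against the
  truncated difference \<open>d - e\<close>, which would otherwise pick the component of degree
  0.\<close>

lemma hcomp_mult:
  assumes "is_hom e f"
  shows "hcomp d (q * f) = (if e \<le> d then hcomp (d - e) q * f else 0)"
  using assms
proof (induct f rule: mpol_keys_induct)
  case (add m c f)
  then have m: "monom_deg m = e" and f: "is_hom e f"
    by (simp_all add: is_hom_def keys_single_add)
  have "hcomp d (q * Poly_Mapping.single m c)
      = (if e \<le> d then hcomp (d - e) q * Poly_Mapping.single m c else 0)"
    by (induct q rule: mpol_keys_induct)
       (auto simp: hcomp_add distrib_right mult_single hcomp_def filt_single filt_add monom_deg_add m)
  with add f show ?case by (simp add: distrib_left hcomp_add)
qed simp

lemma is_hom_mult:
  assumes "is_hom d p" "is_hom e q"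
  shows "is_hom (d + e) (p * q)"
  unfolding is_hom_def
proof
  fix m assume "m \<in> Poly_Mapping.keys (p * q)"
  then obtain a b where "m = a + b" "a \<in> Poly_Mapping.keys p" "b \<in> Poly_Mapping.keys q"
    using keys_mult[of p q] by blast
  with assms show "monom_deg m = d + e" by (simp add: is_hom_def monom_deg_add)
qed

lemma is_hom_add: "is_hom d p \<Longrightarrow> is_hom d q \<Longrightarrow> is_hom d (p + q)"
  using Poly_Mapping.keys_add[of p q] by (auto simp: is_hom_def)

lemma is_hom_diff: "is_hom d p \<Longrightarrow> is_hom d q \<Longrightarrow> is_hom d (p - q)"
  using keys_diff[of p q] by (auto simp: is_hom_def)

lemma is_hom_mvar: "is_hom 1 (mvar v)" "is_hom (Suc 0) (mvar v)"
  by (simp_all add: is_hom_def mvar_def monom_deg_single)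

lemma sum_hcomp: "finite D \<Longrightarrow> monom_deg ` Poly_Mapping.keys p \<subseteq> D \<Longrightarrow> (\<Sum>d\<in>D. hcomp d p) = p"
proof (induct p rule: mpol_keys_induct)
  case (add m c p)
  then have "(\<Sum>d\<in>D. hcomp d (Poly_Mapping.single m c)) = Poly_Mapping.single m c"
    by (auto simp: hcomp_def filt_single keys_single_add sum.delta)
  with add show ?case by (simp add: hcomp_add sum.distrib keys_single_add)
qed simp

lemma pol_carrier_filt: "p \<in> pol_carrier n \<Longrightarrow> filt Q p \<in> pol_carrier n"
  by (auto simp: pol_carrier_def keys_filt)

lemma pol_carrier_kill: "p \<in> pol_carrier n \<Longrightarrow> kill v p \<in> pol_carrier n"
  by (simp add: kill_def pol_carrier_filt)

lemma pol_carrier_hcomp: "p \<in> pol_carrier n \<Longrightarrow> hcomp d p \<in> pol_carrier n"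
  by (simp add: hcomp_def pol_carrier_filt)

lemma pol_carrier_shift:
  assumes "p \<in> pol_carrier n" shows "shift v p \<in> pol_carrier n"
proof -
  have "Poly_Mapping.keys m \<subseteq> XVar ` {1..n} \<union> YVar ` {1..n}"
    if "m \<in> Poly_Mapping.keys (shift v p)" for m
  proof -
    from that have "m + Poly_Mapping.single v 1 \<in> Poly_Mapping.keys p"
      by (simp add: in_keys_iff lookup_shift)
    with assms have "Poly_Mapping.keys (m + Poly_Mapping.single v 1) \<subseteq> XVar ` {1..n} \<union> YVar ` {1..n}"
      by (auto simp: pol_carrier_def)
    moreover have "Poly_Mapping.keys m \<subseteq> Poly_Mapping.keys (m + Poly_Mapping.single v 1)"
      by (auto simp: in_keys_iff lookup_add)
    ultimately show ?thesis by blast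
  qed
  then show ?thesis by (auto simp: pol_carrier_def)
qed

lemma pol_carrier_diff:
  "p \<in> pol_carrier n \<Longrightarrow> q \<in> pol_carrier n \<Longrightarrow> p - q \<in> pol_carrier n"
  using pol_carrier_add[of p n "- q"] pol_carrier_uminus[of q n] by simp

lemma pol_carrier_mvar:
  "mvar v \<in> pol_carrier n \<longleftrightarrow> v \<in> XVar ` {1..n} \<union> YVar ` {1..n}"
  by (simp add: pol_carrier_def mvar_def)

lemma pol_carrier_const: "const_pol c \<in> pol_carrier n"
  by (auto simp: pol_carrier_def const_pol_def)

lemmas pol_carrier_intros = pol_carrier_simps pol_carrier_add pol_carrier_uminus pol_carrier_mult
  pol_carrier_diff pol_carrier_const

section \<open>Ideals\<close>

text \<open>Linear combinations built one summand at a time. For generators in the ring this is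
  \<open>genideal\<close> (see \<open>genideal_eq_idl\<close>), but with an induction rule that
  follows the generators.\<close>

inductive_set idl :: "nat \<Rightarrow> 'k::field mpol set \<Rightarrow> 'k mpol set" for n F where
  zero: "0 \<in> idl n F"
| step: "f \<in> F \<Longrightarrow> q \<in> pol_carrier n \<Longrightarrow> p \<in> idl n F \<Longrightarrow> q * f + p \<in> idl n F"

lemma idl_add: "p \<in> idl n F \<Longrightarrow> q \<in> idl n F \<Longrightarrow> p + q \<in> idl n F"
  by (induct p rule: idl.induct) (auto simp: add.assoc intro: idl.step)

lemma idl_mult: "p \<in> idl n F \<Longrightarrow> q \<in> pol_carrier n \<Longrightarrow> q * p \<in> idl n F"
proof (induct p rule: idl.induct)
  case (step f r p)
  then have "(q * r) * f + q * p \<in> idl n F"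
    by (intro idl.step) (auto intro: pol_carrier_intros)
  then show ?case by (simp add: algebra_simps)
qed (simp add: idl.zero)

lemma idl_mult_right: "p \<in> idl n F \<Longrightarrow> q \<in> pol_carrier n \<Longrightarrow> p * q \<in> idl n F"
  using idl_mult by (simp add: mult.commute)

lemma idl_uminus: "p \<in> idl n F \<Longrightarrow> - p \<in> idl n F"
  using idl_mult[of p n F "- 1"] by (simp add: pol_carrier_intros)

lemma idl_diff: "p \<in> idl n F \<Longrightarrow> q \<in> idl n F \<Longrightarrow> p - q \<in> idl n F"
  using idl_add[of p n F "- q"] idl_uminus by fastforce

lemma idl_base: "f \<in> F \<Longrightarrow> f \<in> idl n F"
  using idl.step[of f F 1 n 0] by (simp add: pol_carrier_simps idl.zero)

lemma idl_empty: "idl n {} = {0}"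
  by (auto intro: idl.zero elim: idl.cases)

lemma idl_subset:
  assumes "F \<subseteq> idl n G" shows "idl n F \<subseteq> idl n G"
proof
  fix p assume "p \<in> idl n F"
  then show "p \<in> idl n G"
    by induct (use assms in \<open>auto intro: idl.zero idl_add idl_mult\<close>)
qed

lemma idl_mono: "F \<subseteq> G \<Longrightarrow> idl n F \<subseteq> idl n G"
  by (intro idl_subset) (auto intro: idl_base)

lemma idl_carrier: "F \<subseteq> pol_carrier n \<Longrightarrow> idl n F \<subseteq> pol_carrier n"
proof
  fix p assume "F \<subseteq> pol_carrier n" and "p \<in> idl n F"
  from this(2,1) show "p \<in> pol_carrier n"
    by induct (auto intro: pol_carrier_intros)
qed

text \<open>All contributions of \<open>g\<close> are collected into one multiple. In this form a
  relation modulo the larger ideal can be substituted into and divided.\<close>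

lemma idl_insert_iff:
  "p \<in> idl n (insert g F) \<longleftrightarrow> (\<exists>j\<in>idl n F. \<exists>q\<in>pol_carrier n. p = j + g * q)"
proof
  assume "p \<in> idl n (insert g F)"
  then show "\<exists>j\<in>idl n F. \<exists>q\<in>pol_carrier n. p = j + g * q"
  proof induct
    case zero
    show ?case by (intro bexI[of _ 0]) (auto intro: idl.zero pol_carrier_simps)
  next
    case (step f q p)
    then obtain j r where jr: "j \<in> idl n F" "r \<in> pol_carrier n" "p = j + g * r" by blast
    show ?case
    proof (cases "f = g")
      case True
      with jr step show ?thesis
        by (intro bexI[of _ j] bexI[of _ "q + r"]) (auto simp: algebra_simps intro: pol_carrier_intros)
    next
      case False
      with step have "q * f + j \<in> idl n F" using jr by (auto intro: idl.step)
      moreover have "q * f + p = q * f + j + g * r" using jr by (simp add: add.assoc)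
      ultimately show ?thesis using jr by blast
    qed
  qed
next
  assume "\<exists>j\<in>idl n F. \<exists>q\<in>pol_carrier n. p = j + g * q"
  then obtain j q where jq: "j \<in> idl n F" "q \<in> pol_carrier n" "p = j + g * q" by blast
  then have "j \<in> idl n (insert g F)" using idl_mono[of F "insert g F"] by blast
  then show "p \<in> idl n (insert g F)"
    using jq idl_mult[OF idl_base[of g "insert g F"], of q n]
    by (simp add: idl_add mult.commute)
qed

lemma idl_insertE:
  assumes "p \<in> idl n (insert g F)"
  obtains j q where "j \<in> idl n F" "q \<in> pol_carrier n" "p = j + g * q"
  using assms idl_insert_iff by blast

lemma idl_insertI:
  "j \<in> idl n F \<Longrightarrow> q \<in> pol_carrier n \<Longrightarrow> j + g * q \<in> idl n (insert g F)"
  using idl_insert_iff by blast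

lemma idl_eqI: "F \<subseteq> idl n G \<Longrightarrow> G \<subseteq> idl n F \<Longrightarrow> idl n F = idl n G"
  by (intro equalityI idl_subset)

text \<open>The degree may vary with the generator, since variables and quadratic binomials will
  occur side by side.\<close>

definition hom_gens :: "nat \<Rightarrow> 'k::field mpol set \<Rightarrow> bool" where
  "hom_gens n F \<longleftrightarrow> (\<forall>f\<in>F. f \<in> pol_carrier n \<and> (\<exists>d. is_hom d f))"

lemma hom_gens_empty [simp]: "hom_gens n {}"
  by (simp add: hom_gens_def)

lemma hom_gens_insert:
  "hom_gens n (insert g F) \<longleftrightarrow> g \<in> pol_carrier n \<and> (\<exists>d. is_hom d g) \<and> hom_gens n F"
  by (auto simp: hom_gens_def)

lemma hom_gens_carrier: "hom_gens n F \<Longrightarrow> idl n F \<subseteq> pol_carrier n"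
  by (intro idl_carrier) (auto simp: hom_gens_def)

lemma idl_hcomp: "hom_gens n F \<Longrightarrow> p \<in> idl n F \<Longrightarrow> hcomp d p \<in> idl n F"
proof -
  assume F: "hom_gens n F" and "p \<in> idl n F"
  from this(2) show ?thesis
  proof induct
    case (step f q p)
    then obtain e where "is_hom e f" using F by (auto simp: hom_gens_def)
    with step show ?case
      by (auto simp: hcomp_add hcomp_mult intro!: idl.step pol_carrier_hcomp)
  qed (simp add: idl.zero)
qed

definition fresh :: "pvar \<Rightarrow> 'k::field mpol set \<Rightarrow> bool" where
  "fresh v F \<longleftrightarrow> (\<forall>f\<in>F. avoids v f)"

lemma fresh_empty [simp]: "fresh v {}"
  by (simp add: fresh_def)

lemma fresh_insert: "fresh v (insert g F) \<longleftrightarrow> avoids v g \<and> fresh v F"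
  by (auto simp: fresh_def)

lemma fresh_Un: "fresh v (F \<union> G) \<longleftrightarrow> fresh v F \<and> fresh v G"
  by (auto simp: fresh_def)

text \<open>The generators do not involve \<open>v\<close>, so the substitution acts on the
  coefficients alone. Together with \<open>idl_shift\<close> this says that membership can be tested
  coefficientwise in powers of \<open>v\<close>.\<close>

lemma idl_kill: "fresh v F \<Longrightarrow> p \<in> idl n F \<Longrightarrow> kill v p \<in> idl n F"
proof -
  assume F: "fresh v F" and "p \<in> idl n F"
  from this(2) show ?thesis
    by induct (use F in \<open>auto simp: kill_add kill_mult fresh_def kill_avoids
      intro!: idl.step pol_carrier_kill idl.zero\<close>)
qed

lemma idl_shift: "fresh v F \<Longrightarrow> p \<in> idl n F \<Longrightarrow> shift v p \<in> idl n F"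
proof -
  assume F: "fresh v F" and "p \<in> idl n F"
  from this(2) show ?thesis
    by induct (use F in \<open>auto simp: shift_add shift_mult fresh_def
      intro!: idl.step pol_carrier_shift idl.zero\<close>)
qed

text \<open>For empty \<open>F\<close> this says that multiplication by \<open>g\<close> is
  injective on the polynomial ring, as \<open>idl n {} = {0}\<close>. The unit ideal satisfies it
  trivially.\<close>

definition nzd :: "nat \<Rightarrow> 'k::field mpol set \<Rightarrow> 'k mpol \<Rightarrow> bool" where
  "nzd n F g \<longleftrightarrow> (\<forall>h\<in>pol_carrier n. g * h \<in> idl n F \<longrightarrow> h \<in> idl n F)"

lemma nzdD: "nzd n F g \<Longrightarrow> g * h \<in> idl n F \<Longrightarrow> h \<in> pol_carrier n \<Longrightarrow> h \<in> idl n F"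
  by (simp add: nzd_def)

lemma nzd_cong: "idl n F = idl n G \<Longrightarrow> nzd n F g = nzd n G g"
  by (simp add: nzd_def)

text \<open>Multiplication by an absent variable is undone by \<open>shift\<close>, which preserves
  the ideal.\<close>

lemma nzd_fresh: "fresh v F \<Longrightarrow> nzd n F (mvar v)"
  unfolding nzd_def by (metis idl_shift shift_mvar_mult)

text \<open>Induction on the degree in \<open>c\<close>: modulo \<open>c\<close> the binomial \<open>a d - c b\<close> is \<open>a d\<close>.\<close>

lemma nzd_binomial:
  assumes fr: "fresh c F" "fresh d F" and nz: "nzd n F a" and a: "avoids c a"
    and cd: "c \<noteq> d" and F: "F \<subseteq> pol_carrier n"
    and S: "a \<in> pol_carrier n" "b \<in> pol_carrier n" "mvar c \<in> (pol_carrier n :: 'k::field mpol set)"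
      "mvar d \<in> (pol_carrier n :: 'k mpol set)"
  shows "nzd n F (a * mvar d - mvar c * (b :: 'k mpol))"
  unfolding nzd_def
proof (intro ballI impI)
  fix h
  assume h: "h \<in> pol_carrier n" "(a * mvar d - mvar c * b) * h \<in> idl n F"
  obtain k where "(shift c ^^ k) h = 0" using funpow_shift_eventually_0 by blast
  with h show "h \<in> idl n F"
  proof (induct k arbitrary: h)
    case (Suc k)
    let ?f = "a * mvar d - mvar c * b" and ?h0 = "kill c h"
    have h0: "?h0 \<in> pol_carrier n" using Suc.prems pol_carrier_kill by blast
    have "kill c (?f * h) \<in> idl n F" using fr Suc.prems by (intro idl_kill)
    then have "mvar d * (a * ?h0) \<in> idl n F"
      using a cd by (simp add: kill_mult kill_diff kill_mvar kill_avoids algebra_simps)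
    then have "a * ?h0 \<in> idl n F"
      using nzdD[OF nzd_fresh[OF fr(2)]] h0 S by (simp add: pol_carrier_mult)
    then have h0J: "?h0 \<in> idl n F" using nzdD[OF nz] h0 by blast
    have fS: "?f \<in> pol_carrier n" using S by (intro pol_carrier_intros)
    have "?f * h - ?f * ?h0 \<in> idl n F"
      by (intro idl_diff[OF Suc.prems(2)] idl_mult[OF h0J fS])
    moreover have "h - ?h0 = mvar c * shift c h" using kill_split[of h c] by (simp add: algebra_simps)
    ultimately have "mvar c * (?f * shift c h) \<in> idl n F"
      by (simp only: right_diff_distrib[symmetric] mult.left_commute)
    then have "?f * shift c h \<in> idl n F"
      using nzdD[OF nzd_fresh[OF fr(1)]] fS Suc.prems
      by (simp add: pol_carrier_mult pol_carrier_shift)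
    moreover have "(shift c ^^ k) (shift c h) = 0"
      using Suc.prems by (simp add: funpow_swap1)
    ultimately have "shift c h \<in> idl n F"
      using Suc.hyps Suc.prems by (simp add: pol_carrier_shift)
    then have "?h0 + mvar c * shift c h \<in> idl n F"
      using h0J S by (intro idl_add idl_mult)
    then show ?case using kill_split[of h c] by simp
  qed (simp add: idl.zero)
qed

text \<open>In a relation \<open>mvar c * h = j + f * p\<close>, where \<open>f\<close> is the
  binomial, setting \<open>c\<close> to 0 leaves \<open>a * mvar d\<close> times the part of
  \<open>p\<close> free of \<open>c\<close>. That part therefore lies in the ideal, the rest of
  \<open>p\<close> is divisible by \<open>c\<close>, and \<open>c\<close> cancels from the whole
  relation.\<close>

lemma nzd_new_var:
  assumes fr: "fresh c F" "fresh d F" and nz: "nzd n F a" and a: "avoids c a"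
    and cd: "c \<noteq> d" and F: "F \<subseteq> pol_carrier n"
    and S: "a \<in> pol_carrier n" "b \<in> pol_carrier n" "mvar c \<in> (pol_carrier n :: 'k::field mpol set)"
      "mvar d \<in> (pol_carrier n :: 'k mpol set)"
  shows "nzd n (insert (a * mvar d - mvar c * (b :: 'k mpol)) F) (mvar c)"
  unfolding nzd_def
proof (intro ballI impI)
  let ?f = "a * mvar d - mvar c * b"
  fix h
  assume h: "h \<in> pol_carrier n" "mvar c * h \<in> idl n (insert ?f F)"
  obtain j p where jp: "j \<in> idl n F" "p \<in> pol_carrier n" "mvar c * h = j + ?f * p"
    using h by (elim idl_insertE)
  have fS: "?f \<in> pol_carrier n" using S by (intro pol_carrier_intros)
  have "kill c (mvar c * h - ?f * p) \<in> idl n F"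
    using fr jp by (intro idl_kill) simp_all
  moreover have "kill c (mvar c * h - ?f * p) = - (mvar d * (a * kill c p))"
    unfolding kill_mult kill_diff kill_mvar using a cd by (simp add: kill_avoids)
  ultimately have "- (mvar d * (a * kill c p)) \<in> idl n F" by simp
  then have "mvar d * (a * kill c p) \<in> idl n F" using idl_uminus by force
  then have "a * kill c p \<in> idl n F"
    using nzdD[OF nzd_fresh[OF fr(2)]] jp S by (simp add: pol_carrier_mult pol_carrier_kill)
  then have p0: "kill c p \<in> idl n F" using nzdD[OF nz] jp pol_carrier_kill by blast
  have "kill c p = p - mvar c * shift c p" using kill_split[of p c] by (simp add: algebra_simps)
  then have "mvar c * (h - ?f * shift c p) = j + ?f * kill c p"
    using jp(3) by (simp only: right_diff_distrib) (simp add: ac_simps)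
  also have "\<dots> \<in> idl n F" using jp p0 fS by (intro idl_add idl_mult)
  finally have "h - ?f * shift c p \<in> idl n F"
    using nzdD[OF nzd_fresh[OF fr(1)]] h fS jp by (simp add: pol_carrier_intros pol_carrier_shift)
  then have "h - ?f * shift c p + ?f * shift c p \<in> idl n (insert ?f F)"
    using jp by (intro idl_insertI pol_carrier_shift)
  then show "h \<in> idl n (insert ?f F)" by simp
qed

section \<open>Hilbert series\<close>

lemma (in vector_space) independent_Un:
  assumes "independent A" "finite B" "independent B" "span A \<inter> span B \<subseteq> {0}"
  shows "independent (A \<union> B)"
  using assms(2-4)
proof (induct B rule: finite_induct)
  case (insert b B)
  have B: "independent B" "b \<notin> span B"
    using insert by (auto simp: independent_insert)
  have "span B \<subseteq> span (insert b B)" by (intro span_mono) blast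
  with insert B have "independent (A \<union> B)" by blast
  moreover have "b \<notin> span (A \<union> B)"
  proof
    assume "b \<in> span (A \<union> B)"
    then obtain x y where xy: "b = x + y" "x \<in> span A" "y \<in> span B"
      by (auto simp: span_Un)
    have "b - y \<in> span (insert b B)"
      using xy \<open>span B \<subseteq> _\<close> by (intro span_diff) (auto intro: span_base)
    with xy insert.prems have "x = 0" by auto
    with xy B show False by simp
  qed
  ultimately show ?case by (simp add: independent_insertI)
qed (simp add: assms(1))

lemma (in vector_space) independent_span_Int:
  assumes "finite C" "independent (B \<union> C)" "B \<inter> C = {}"
  shows "span B \<inter> span C \<subseteq> {0}"
  using assms
proof (induct C rule: finite_induct)
  case (insert c C)
  have c: "c \<notin> span (B \<union> C)" "independent (B \<union> C)"
    using insert by (auto simp: independent_insert split: if_splits)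
  show ?case
  proof
    fix x assume x: "x \<in> span B \<inter> span (insert c C)"
    then obtain k where k: "x - scale k c \<in> span C" by (auto simp: span_breakdown_eq)
    have "x \<in> span (B \<union> C)" "x - scale k c \<in> span (B \<union> C)"
      using x k span_mono[of B "B \<union> C"] span_mono[of C "B \<union> C"] by auto
    from span_diff[OF this] have "scale k c \<in> span (B \<union> C)" by simp
    with c have "k = 0"
      by (metis span_scale scale_scale left_inverse scale_one)
    with k x c insert show "x \<in> {0}" by auto
  qed
qed auto

section \<open>The polynomial ring as a vector space over its constants\<close>

abbreviation scal :: "'k::field \<Rightarrow> 'k mpol \<Rightarrow> 'k mpol" where
  "scal c p \<equiv> const_pol c * p"

lemma const_pol_simps:
  "const_pol 0 = 0" "const_pol 1 = 1" "const_pol (a + b) = const_pol a + const_pol b"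
  "const_pol (a * b) = const_pol a * const_pol b"
  by (simp_all add: const_pol_def single_add mult_single)

interpretation mp: vector_space "scal :: 'k::field \<Rightarrow> 'k mpol \<Rightarrow> 'k mpol"
  by unfold_locales (simp_all add: const_pol_simps distrib_left distrib_right mult.assoc)

lemma homogeneous_part_iff: "p \<in> homogeneous_part n d \<longleftrightarrow> p \<in> pol_carrier n \<and> is_hom d p"
  by (simp add: homogeneous_part_def is_hom_def)

lemma is_hom_const: "is_hom 0 (const_pol c)"
  by (simp add: is_hom_def const_pol_def monom_deg_def)

lemma is_hom_scal: "is_hom d p \<Longrightarrow> is_hom d (scal c p)"
  using is_hom_mult[OF is_hom_const] by fastforce

lemma subspace_hom: "mp.subspace (homogeneous_part n d)"
  by (auto simp: mp.subspace_def homogeneous_part_iff is_hom_add is_hom_scal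
      intro: pol_carrier_intros)

lemma subspace_idl: "mp.subspace (idl n F)"
  by (auto simp: mp.subspace_def intro: idl.zero idl_add idl_mult pol_carrier_const)

lemma finite_monoms:
  "finite {m. Poly_Mapping.keys m \<subseteq> XVar ` {1..n} \<union> YVar ` {1..n} \<and> monom_deg m = d}" (is "finite ?M")
proof (rule finite_imageD)
  let ?U = "XVar ` {1..n} \<union> YVar ` {1..n}"
  show "inj_on Poly_Mapping.lookup ?M" by (auto simp: inj_on_def intro: poly_mapping_eqI)
  have "Poly_Mapping.lookup ` ?M \<subseteq> {f. \<forall>v. (v \<in> ?U \<longrightarrow> f v \<in> {..d}) \<and> (v \<notin> ?U \<longrightarrow> f v = 0)}"
  proof clarify
    fix m v
    assume m: "Poly_Mapping.keys m \<subseteq> ?U" and d: "d = monom_deg m"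
    have "Poly_Mapping.lookup m v \<le> monom_deg m"
      using member_le_sum[of v "Poly_Mapping.keys m" "Poly_Mapping.lookup m"]
      by (cases "v \<in> Poly_Mapping.keys m") (auto simp: monom_deg_def in_keys_iff)
    moreover have "Poly_Mapping.lookup m v = 0" if "v \<notin> ?U"
      using m that by (auto simp: in_keys_iff)
    ultimately show "(v \<in> ?U \<longrightarrow> Poly_Mapping.lookup m v \<in> {..monom_deg m})
        \<and> (v \<notin> ?U \<longrightarrow> Poly_Mapping.lookup m v = 0)" by simp
  qed
  then show "finite (Poly_Mapping.lookup ` ?M)"
    by (rule finite_subset) (intro finite_set_of_finite_funs, auto)
qed

lemma homogeneous_part_span:
  obtains B where "finite B" "homogeneous_part n d \<subseteq> mp.span (B :: 'k::field mpol set)"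
proof
  let ?M = "{m. Poly_Mapping.keys m \<subseteq> XVar ` {1..n} \<union> YVar ` {1..n} \<and> monom_deg m = d}"
  let ?B = "(\<lambda>m. Poly_Mapping.single m 1) ` ?M :: 'k mpol set"
  show "finite ?B" using finite_monoms by blast
  show "homogeneous_part n d \<subseteq> mp.span ?B"
  proof
    fix p :: "'k mpol"
    assume "p \<in> homogeneous_part n d"
    then have "Poly_Mapping.keys p \<subseteq> ?M" by (auto simp: homogeneous_part_def pol_carrier_def)
    then show "p \<in> mp.span ?B"
    proof (induct p rule: mpol_keys_induct)
      case zero
      then show ?case by (simp add: mp.span_zero)
    next
      case (add m c p)
      then have "scal c (Poly_Mapping.single m 1) \<in> mp.span ?B"
        by (intro mp.span_scale mp.span_base) (auto simp: keys_single_add)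
      then have "Poly_Mapping.single m c \<in> mp.span ?B"
        by (simp add: const_pol_def mult_single)
      with add show ?case by (auto simp: keys_single_add intro: mp.span_add)
    qed
  qed
qed

section \<open>Hilbert functions and the effect of one more generator\<close>

definition hdim :: "nat \<Rightarrow> 'k::field mpol set \<Rightarrow> nat \<Rightarrow> nat" where
  "hdim n J d = mp.dim (J \<inter> homogeneous_part n d)"

text \<open>The series of the quotient, computed from dimensions inside the polynomial ring. It
  takes an arbitrary set \<open>J\<close>, so that it applies to a colon ideal before generators of
  it are known; the difference is taken in the rationals and hence never truncated.\<close>

definition hser :: "nat \<Rightarrow> 'k::field mpol set \<Rightarrow> rat fps" where
  "hser n J = Abs_fps (\<lambda>d. of_nat (hdim n (UNIV :: 'k mpol set) d) - of_nat (hdim n J d))"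

lemma finite_indep_hom:
  assumes "mp.independent B" "B \<subseteq> homogeneous_part n d" shows "finite B"
proof -
  obtain C :: "'a mpol set" where "finite C" "homogeneous_part n d \<subseteq> mp.span C"
    using homogeneous_part_span by blast
  with assms show ?thesis using mp.independent_span_bound by blast
qed

lemma hdim_basis:
  obtains B where "B \<subseteq> J \<inter> homogeneous_part n d" "finite B" "mp.independent B"
    "J \<inter> homogeneous_part n d \<subseteq> mp.span B" "card B = hdim n J d"
  using mp.basis_exists[of "J \<inter> homogeneous_part n d"] finite_indep_hom
  unfolding hdim_def by (metis Int_subset_iff)

text \<open>A basis of the smaller degree part is prolonged to one of the larger, so the size of
  \<open>C\<close> is the jump in dimension.\<close>

lemma hdim_extend:
  assumes "J \<subseteq> J'" and sJ: "mp.subspace J"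
  obtains B C where "B \<subseteq> J \<inter> homogeneous_part n d" "C \<subseteq> J' \<inter> homogeneous_part n d"
    "B \<inter> C = {}" "finite B" "finite C" "mp.independent (B \<union> C)"
    "J \<inter> homogeneous_part n d = mp.span B"
    "J' \<inter> homogeneous_part n d \<subseteq> mp.span (B \<union> C)"
    "card B = hdim n J d" "card B + card C = hdim n J' d"
proof -
  obtain B where B: "B \<subseteq> J \<inter> homogeneous_part n d" "finite B" "mp.independent B"
    "J \<inter> homogeneous_part n d \<subseteq> mp.span B" "card B = hdim n J d"
    using hdim_basis by blast
  obtain D where D: "B \<subseteq> D" "D \<subseteq> J' \<inter> homogeneous_part n d" "mp.independent D"
    "J' \<inter> homogeneous_part n d \<subseteq> mp.span D"
    using mp.maximal_independent_subset_extend[of B "J' \<inter> homogeneous_part n d"] B assms by blast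
  have fD: "finite D" using D finite_indep_hom by blast
  have cD: "card D = hdim n J' d"
    unfolding hdim_def by (rule mp.basis_card_eq_dim[OF D(2,4,3)])
  have "mp.span B \<subseteq> J \<inter> homogeneous_part n d"
    using B(1) sJ subspace_hom by (intro mp.span_minimal mp.subspace_inter)
  with B have sp: "J \<inter> homogeneous_part n d = mp.span B" by blast
  have DB: "B \<union> D = D" using D by blast
  show thesis
    by (rule that[of B "D - B"])
       (use B D fD cD sp card_Diff_subset[of B D] card_mono[of D B] in \<open>auto simp: DB\<close>)
qed

lemma hdim_mono: "J \<subseteq> J' \<Longrightarrow> mp.subspace J \<Longrightarrow> hdim n J d \<le> hdim n J' d"
  by (rule hdim_extend[of J J' n d]) auto

lemma hdim_eq_imp:
  assumes "J \<subseteq> J'" "mp.subspace J" "hdim n J d = hdim n J' d"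
  shows "J' \<inter> homogeneous_part n d \<subseteq> J"
proof -
  obtain B C where "J \<inter> homogeneous_part n d = mp.span B" "finite C"
    "J' \<inter> homogeneous_part n d \<subseteq> mp.span (B \<union> C)"
    "card B = hdim n J d" "card B + card C = hdim n J' d"
    by (rule hdim_extend[OF assms(1,2), of n d]) (rule that; assumption)
  with assms(3) show ?thesis by auto
qed

definition colon :: "nat \<Rightarrow> 'k::field mpol set \<Rightarrow> 'k mpol \<Rightarrow> 'k mpol set" where
  "colon n F g = {h \<in> pol_carrier n. g * h \<in> idl n F}"

lemma subspace_colon: "mp.subspace (colon n F g)"
  unfolding colon_def mp.subspace_def
  by (auto simp: distrib_left mult.left_commute[of g]
      intro: pol_carrier_intros idl.zero idl_add idl_mult)

text \<open>The exact sequence in one degree, as an equation of sums. Let \<open>C\<close> complete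
  a basis of the colon ideal in degree \<open>d\<close> to a basis of all forms of degree
  \<open>d\<close>. Multiplication by \<open>g\<close> is injective on the span of \<open>C\<close>
  and sends it to a complement of the ideal of \<open>F\<close> within the enlarged ideal in degree
  \<open>d + e\<close>.\<close>

lemma hdim_insert:
  fixes g :: "'k::field mpol"
  assumes F: "hom_gens n F" and g: "g \<in> pol_carrier n" "is_hom e g"
    and inj: "nzd n {} g"
  shows "hdim n (idl n (insert g F)) (d + e) + hdim n (colon n F g) d
      = hdim n (idl n F) (d + e) + hdim n (UNIV :: 'k mpol set) d"
proof -
  obtain B C where BC: "B \<subseteq> colon n F g \<inter> homogeneous_part n d"
    "C \<subseteq> UNIV \<inter> homogeneous_part n d" "B \<inter> C = {}" "finite B" "finite C"
    "mp.independent (B \<union> C)" "colon n F g \<inter> homogeneous_part n d = mp.span B"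
    "UNIV \<inter> homogeneous_part n d \<subseteq> mp.span (B \<union> C)"
    "card B = hdim n (colon n F g) d" "card B + card C = hdim n (UNIV :: 'k mpol set) d"
    by (rule hdim_extend[OF subset_UNIV subspace_colon[of n F g], of n d]) (rule that; assumption)
  obtain A where A: "A \<subseteq> idl n F \<inter> homogeneous_part n (d + e)" "finite A" "mp.independent A"
    "idl n F \<inter> homogeneous_part n (d + e) \<subseteq> mp.span A" "card A = hdim n (idl n F) (d + e)"
    using hdim_basis by blast
  interpret lin: Vector_Spaces.linear scal scal "(*) g"
    by unfold_locales (simp_all add: distrib_left mult.left_commute)
  have hp: "g * h \<in> homogeneous_part n (d + e)" if "h \<in> homogeneous_part n d" for h
    using that g is_hom_mult[of e g d h]
    by (simp add: homogeneous_part_iff pol_carrier_mult add.commute)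
  have spanA: "mp.span A = idl n F \<inter> homogeneous_part n (d + e)"
    using A(1,4) subspace_idl subspace_hom
    by (intro equalityI mp.span_minimal mp.subspace_inter)
  have spanC: "mp.span C \<subseteq> homogeneous_part n d"
    using BC(2) by (intro mp.span_minimal subspace_hom) blast
  have CB: "mp.span B \<inter> mp.span C \<subseteq> {0}"
    using BC(3,5,6) by (intro mp.independent_span_Int)
  \<comment> \<open>A form that \<open>g\<close> carries into the ideal belongs to the colon ideal,
    whose degree part meets the span of \<open>C\<close> only in 0.\<close>
  have inter: "h = 0" if "h \<in> mp.span C" "g * h \<in> mp.span A" for h
  proof -
    have "h \<in> homogeneous_part n d" using that spanC by blast
    then have "h \<in> colon n F g \<inter> homogeneous_part n d"
      using that spanA by (auto simp: colon_def homogeneous_part_iff)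
    with BC(7) CB that show ?thesis by blast
  qed
  have injC: "inj_on ((*) g) (mp.span C)"
  proof (rule inj_onI)
    fix x y assume xy: "x \<in> mp.span C" "y \<in> mp.span C" "g * x = g * y"
    then have "x - y \<in> pol_carrier n"
      using spanC by (auto simp: homogeneous_part_iff intro!: pol_carrier_diff)
    moreover have "g * (x - y) = 0" using xy(3) by (simp add: right_diff_distrib)
    ultimately show "x = y" using nzdD[OF inj, of "x - y"] by (simp add: idl_empty)
  qed
  let ?D = "A \<union> (*) g ` C"
  have indC: "mp.independent C" using BC(6) mp.independent_mono by blast
  have indgC: "mp.independent ((*) g ` C)"
    by (rule lin.independent_injective_image[OF indC injC])
  have DD: "(mp.span A) \<inter> mp.span ((*) g ` C) \<subseteq> {0}"
  proof
    fix x assume x: "x \<in> mp.span A \<inter> mp.span ((*) g ` C)"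
    then obtain h where h: "h \<in> mp.span C" "x = g * h" by (auto simp: lin.span_image)
    with x inter have "h = 0" by simp
    with h show "x \<in> {0}" by simp
  qed
  have indD: "mp.independent ?D"
    using BC(5) by (intro mp.independent_Un A(3) indgC DD) simp
  have disj: "A \<inter> (*) g ` C = {}"
  proof -
    have "x = 0" if "x \<in> A" "x \<in> (*) g ` C" for x
    proof -
      have "x \<in> mp.span A" "x \<in> mp.span ((*) g ` C)" using that by (auto intro: mp.span_base)
      with DD show ?thesis by auto
    qed
    then have "A \<inter> (*) g ` C \<subseteq> A \<inter> {0}" by (intro subsetI) simp
    moreover have "0 \<notin> A" using A(3) mp.dependent_zero[of A] by auto
    ultimately show ?thesis by simp
  qed
  have D1: "?D \<subseteq> idl n (insert g F) \<inter> homogeneous_part n (d + e)"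
  proof -
    have "g * h \<in> idl n (insert g F)" if "h \<in> C" for h
      using that BC(2) idl_insertI[OF idl.zero, of h n g F] by (auto simp: homogeneous_part_iff)
    moreover have "A \<subseteq> idl n (insert g F)" using A(1) idl_mono[of F "insert g F" n] by blast
    ultimately show ?thesis using A(1) BC(2) hp by blast
  qed
  have D2: "idl n (insert g F) \<inter> homogeneous_part n (d + e) \<subseteq> mp.span ?D"
  proof clarify
    fix p assume p: "p \<in> idl n (insert g F)" "p \<in> homogeneous_part n (d + e)"
    then obtain j q where jq: "j \<in> idl n F" "q \<in> pol_carrier n" "p = j + g * q"
      by (elim idl_insertE)
    \<comment> \<open>Comparing components replaces the summands \<open>j\<close> and
      \<open>q\<close> by forms. The form of degree \<open>d\<close> is then split along
      \<open>B\<close> and \<open>C\<close>; its part in the span of \<open>B\<close> is multiplied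
      back into the ideal of \<open>F\<close>.\<close>
    have "p = hcomp (d + e) p" 
      using p(2) hcomp_is_hom[of "d + e" p "d + e"] by (simp add: homogeneous_part_iff)
    also have "\<dots> = hcomp (d + e) j + g * hcomp d q"
      using hcomp_mult[OF g(2), of "d + e" q] by (simp add: jq(3) hcomp_add mult.commute)
    finally have p': "p = hcomp (d + e) j + g * hcomp d q" .
    have "hcomp (d + e) j \<in> mp.span A"
      using idl_hcomp[OF F jq(1)] hom_gens_carrier[OF F] spanA
      by (auto simp: homogeneous_part_iff is_hom_hcomp)
    moreover have "hcomp d q \<in> mp.span (B \<union> C)"
      using jq BC(8) by (auto simp: homogeneous_part_iff is_hom_hcomp pol_carrier_hcomp)
    then obtain x y where xy: "hcomp d q = x + y" "x \<in> mp.span B" "y \<in> mp.span C"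
      by (auto simp: mp.span_Un)
    have "x \<in> colon n F g \<inter> homogeneous_part n d" using xy(2) BC(7) by simp
    then have "g * x \<in> mp.span A"
      using spanA hp by (simp add: colon_def)
    moreover have "g * y \<in> mp.span ((*) g ` C)" using xy(3) by (simp add: lin.span_image)
    ultimately have "hcomp (d + e) j + g * x \<in> mp.span ?D" "g * y \<in> mp.span ?D"
      using mp.span_mono[of A ?D] mp.span_mono[of "(*) g ` C" ?D] by (auto intro: mp.span_add)
    then have "hcomp (d + e) j + g * x + g * y \<in> mp.span ?D" by (rule mp.span_add)
    then show "p \<in> mp.span ?D" by (simp add: p' xy(1) distrib_left add.assoc)
  qed
  have "card ?D = hdim n (idl n (insert g F)) (d + e)"
    unfolding hdim_def by (rule mp.basis_card_eq_dim[OF D1 D2 indD])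
  moreover have "card ?D = card A + card C"
    using card_Un_disjoint[OF A(2) _ disj] BC(5)
      card_image[OF inj_on_subset[OF injC mp.span_superset]] by simp
  ultimately show ?thesis using A(5) BC(9,10) by simp
qed

lemma hdim_insert_low:
  assumes F: "hom_gens n F" and g: "is_hom e g" and de: "d < e"
  shows "hdim n (idl n (insert g F)) d = hdim n (idl n F) d"
proof -
  have "p \<in> idl n F" if p: "p \<in> idl n (insert g F)" "is_hom d p" for p
  proof -
    obtain j q where jq: "j \<in> idl n F" "q \<in> pol_carrier n" "p = j + g * q"
      using p(1) by (elim idl_insertE)
    have "p = hcomp d p" using p(2) by (simp add: hcomp_is_hom)
    also have "\<dots> = hcomp d j"
      using hcomp_mult[OF g, of d q] de by (simp add: jq(3) hcomp_add mult.commute)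
    finally show ?thesis using idl_hcomp[OF F jq(1)] by simp
  qed
  then have "idl n (insert g F) \<inter> homogeneous_part n d = idl n F \<inter> homogeneous_part n d"
    using idl_mono[of F "insert g F" n] by (auto simp: homogeneous_part_iff)
  then show ?thesis by (simp add: hdim_def)
qed

theorem hser_insert:
  fixes g :: "'k::field mpol"
  assumes F: "hom_gens n F" and g: "g \<in> pol_carrier n" "is_hom e g"
    and inj: "nzd n {} g"
  shows "hser n (idl n (insert g F)) = hser n (idl n F) - fps_X ^ e * hser n (colon n F g)"
proof (rule fps_ext)
  fix k
  show "fps_nth (hser n (idl n (insert g F))) k
      = fps_nth (hser n (idl n F) - fps_X ^ e * hser n (colon n F g)) k"
  proof (cases "k < e")
    case True
    then show ?thesis
      using hdim_insert_low[OF F g(2)] by (simp add: hser_def fps_X_power_mult_nth)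
  next
    case False
    then obtain d where k: "k = d + e" by (metis le_Suc_ex add.commute not_less)
    have "of_nat (hdim n (idl n (insert g F)) k + hdim n (colon n F g) d)
        = (of_nat (hdim n (idl n F) k + hdim n (UNIV :: 'k mpol set) d) :: rat)"
      using hdim_insert[OF F g inj, of d] by (simp only: k)
    then show ?thesis
      using False k by (simp add: hser_def fps_X_power_mult_nth)
  qed
qed

lemma idl_subset_colon: "hom_gens n F \<Longrightarrow> g \<in> pol_carrier n \<Longrightarrow> idl n F \<subseteq> colon n F g"
  using hom_gens_carrier by (auto simp: colon_def intro: idl_mult)

lemma colon_nzd:
  assumes "hom_gens n F" "g \<in> pol_carrier n"
  shows "colon n F g = idl n F \<longleftrightarrow> nzd n F g"
  using idl_subset_colon[OF assms] by (auto simp: colon_def nzd_def)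

lemma hser_nzd:
  fixes g :: "'k::field mpol"
  assumes "hom_gens n F" "g \<in> pol_carrier n" "is_hom e g" "nzd n {} g" "nzd n F g"
  shows "hser n (idl n (insert g F)) = (1 - fps_X ^ e) * hser n (idl n F)"
  using hser_insert[OF assms(1-4)] assms(5) colon_nzd[OF assms(1,2)]
  by (simp add: left_diff_distrib)

lemma colon_hcomp:
  assumes "hom_gens n F" "is_hom e g" "h \<in> colon n F g"
  shows "hcomp d h \<in> colon n F g"
proof -
  have "hcomp (d + e) (h * g) \<in> idl n F"
    using assms by (intro idl_hcomp) (simp_all add: colon_def mult.commute)
  moreover have "hcomp (d + e) (h * g) = g * hcomp d h"
    using hcomp_mult[OF assms(2), of "d + e" h] by (simp add: mult.commute)
  ultimately show ?thesis using assms by (simp add: colon_def pol_carrier_hcomp)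
qed

text \<open>The equation of series forces the colon ideal to have the dimension of the ideal in
  every degree. As it contains the ideal, their homogeneous parts agree, and since the colon ideal
  contains all components of its elements, so do the ideals.\<close>

lemma nzd_hser:
  fixes g :: "'k::field mpol"
  assumes F: "hom_gens n F" and g: "g \<in> pol_carrier n" "is_hom e g"
    and inj: "nzd n {} g"
    and eq: "hser n (idl n (insert g F)) = (1 - fps_X ^ e) * hser n (idl n F)"
  shows "nzd n F g"
proof -
  have "fps_X ^ e * hser n (colon n F g) = fps_X ^ e * hser n (idl n F)"
    using hser_insert[OF F g inj] eq by (simp add: left_diff_distrib)
  then have h: "hser n (colon n F g) = hser n (idl n F)" by simp
  have "hdim n (colon n F g) d = hdim n (idl n F) d" for d
    using arg_cong[OF h, of "\<lambda>f. fps_nth f d"] by (simp add: hser_def)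
  then have hom: "colon n F g \<inter> homogeneous_part n d \<subseteq> idl n F" for d
    using hdim_eq_imp[OF idl_subset_colon[OF F g(1)] subspace_idl] by metis
  have "h \<in> idl n F" if h: "h \<in> colon n F g" for h
  proof -
    have "hcomp d h \<in> idl n F" for d
    proof -
      have "hcomp d h \<in> colon n F g \<inter> homogeneous_part n d"
        using colon_hcomp[OF F g(2) h, of d]
        by (simp add: homogeneous_part_iff is_hom_hcomp colon_def)
      with hom show ?thesis by blast
    qed
    then have "(\<Sum>d\<in>monom_deg ` Poly_Mapping.keys h. hcomp d h) \<in> idl n F"
      by (intro mp.subspace_sum[OF subspace_idl])
    then show ?thesis by (simp add: sum_hcomp)
  qed
  then show ?thesis using colon_nzd[OF F g(1)] idl_subset_colon[OF F g(1)] by blast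
qed

text \<open>The variables are adjoined one at a time, each absent from what precedes it. The second
  conjunct is carried along for the induction.\<close>

lemma hser_mvars:
  assumes "finite V" "V \<subseteq> XVar ` {1..n} \<union> YVar ` {1..n}" "hom_gens n F"
    "\<And>v. v \<in> V \<Longrightarrow> fresh v F"
  shows "hser n (idl n (mvar ` V \<union> F) :: 'k::field mpol set)
    = (1 - fps_X) ^ card V * hser n (idl n F) \<and> hom_gens n (mvar ` V \<union> F)"
  using assms
proof (induct V rule: finite_induct)
  case (insert v V)
  then have IH: "hser n (idl n (mvar ` V \<union> F)) = (1 - fps_X) ^ card V * hser n (idl n F)"
    and hg: "hom_gens n (mvar ` V \<union> F)" by auto
  have v: "mvar v \<in> pol_carrier n" "is_hom 1 (mvar v)"
    using insert.prems by (auto simp: pol_carrier_mvar is_hom_mvar)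
  have fr: "fresh v (mvar ` V \<union> F)"
    using insert by (auto simp: fresh_Un fresh_def[of _ "mvar ` _"] intro: avoids_mvar)
  have "hser n (idl n (insert (mvar v) (mvar ` V \<union> F)))
      = (1 - fps_X ^ 1) * hser n (idl n (mvar ` V \<union> F))"
    using v by (intro hser_nzd hg nzd_fresh fr) simp_all
  then have "hser n (idl n (mvar ` insert v V \<union> F) :: 'k mpol set)
      = (1 - fps_X) ^ card (insert v V) * hser n (idl n F)"
    using insert.hyps by (simp add: IH mult.assoc)
  moreover have "hom_gens n (mvar ` insert v V \<union> F)"
    using v hg by (auto simp: hom_gens_insert)
  ultimately show ?case by blast
qed simp

text \<open>The series of the polynomial ring without counting monomials: killing all
  \<open>2 * n\<close> variables leaves the field, with series 1, and each variable contributes a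
  factor \<open>1 - fps_X\<close>.\<close>

lemma hser_0: "(1 - fps_X) ^ (2 * n) * hser n (idl n ({} :: 'k::field mpol set)) = 1"
proof -
  let ?V = "XVar ` {1..n} \<union> YVar ` {1..n}"
  let ?F = "mvar ` ?V :: 'k mpol set"
  have fin: "finite ?V" by simp
  have card: "card ?V = 2 * n"
    by (subst card_Un_disjoint) (auto simp: card_image inj_on_def)
  have "hser n (idl n (?F \<union> {}) :: 'k mpol set) = (1 - fps_X) ^ card ?V * hser n (idl n ({} :: 'k mpol set))"
    and hg: "hom_gens n (?F \<union> {})"
    using hser_mvars[OF fin order.refl, of "{} :: 'k mpol set"] by simp_all
  then have "hser n (idl n ?F :: 'k mpol set)
      = (1 - fps_X) ^ (2 * n) * hser n (idl n ({} :: 'k mpol set))"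
    and hg: "hom_gens n ?F" by (simp_all only: card Un_empty_right)
  moreover have "hser n (idl n ?F) = 1"
  proof (rule fps_ext)
    fix d
    have "hdim n (idl n ?F) d = hdim n (UNIV :: 'k mpol set) d" if "d \<noteq> 0"
    proof -
      have "p \<in> idl n ?F" if p: "p \<in> homogeneous_part n d" for p
        using p
      proof (induct p rule: mpol_keys_induct)
        case (add m c p)
        then have m: "monom_deg m = d" "Poly_Mapping.keys m \<subseteq> ?V" and p: "p \<in> homogeneous_part n d"
          by (auto simp: homogeneous_part_def pol_carrier_def keys_single_add)
        from m \<open>d \<noteq> 0\<close> have "Poly_Mapping.keys m \<noteq> {}" by (auto simp: monom_deg_def)
        then obtain v where v: "v \<in> Poly_Mapping.keys m" by blast
        then have "kill v (Poly_Mapping.single m c) = 0"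
          by (simp add: kill_def filt_single in_keys_iff)
        then have "Poly_Mapping.single m c = shift v (Poly_Mapping.single m c) * mvar v"
          using kill_split[of "Poly_Mapping.single m c" v] by (simp add: mult.commute)
        moreover have "Poly_Mapping.single m c \<in> pol_carrier n" using m by (simp add: pol_carrier_def)
        then have "shift v (Poly_Mapping.single m c) * mvar v \<in> idl n ?F"
          using m v by (intro idl_mult idl_base pol_carrier_shift) auto
        ultimately have "Poly_Mapping.single m c \<in> idl n ?F" by simp
        with add p show ?case by (simp add: idl_add)
      qed (rule idl.zero)
      then have "idl n ?F \<inter> homogeneous_part n d = UNIV \<inter> homogeneous_part n d" by blast
      then show ?thesis by (simp add: hdim_def)
    qed
    moreover have "hdim n (idl n ?F) 0 = 0"
    proof -
      have "p = 0" if "p \<in> idl n ?F" "is_hom 0 p" for p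
      proof -
        have "hcomp 0 p = 0" using that(1)
        proof induct
          case (step f q p)
          then obtain v where "f = mvar v" by blast
          with step show ?case using hcomp_mult[OF is_hom_mvar(1), of 0 q v] by (simp add: hcomp_add)
        qed simp
        with that(2) show ?thesis by (simp add: hcomp_is_hom)
      qed
      then have "idl n ?F \<inter> homogeneous_part n 0 \<subseteq> mp.span {}"
        by (auto simp: homogeneous_part_iff)
      then show ?thesis unfolding hdim_def using mp.dim_le_card[of _ "{}"] by simp
    qed
    moreover have "hdim n (UNIV :: 'k mpol set) 0 = 1"
    proof -
      have "p \<in> mp.span {1}" if "p \<in> homogeneous_part n 0" for p :: "'k mpol"
        using that
      proof (induct p rule: mpol_keys_induct)
        case (add m c p)
        then have m: "monom_deg m = 0" and p: "p \<in> homogeneous_part n 0"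
          by (auto simp: homogeneous_part_def pol_carrier_def keys_single_add)
        from m have "m = 0"
          by (intro poly_mapping_eqI) (auto simp: monom_deg_def in_keys_iff)
        then have "Poly_Mapping.single m c = scal c 1" by (simp add: const_pol_def)
        then have "Poly_Mapping.single m c \<in> mp.span {1}"
          by (metis mp.span_scale mp.span_base singletonI)
        with add p show ?case by (simp add: mp.span_add)
      qed (rule mp.span_zero)
      moreover have "(1 :: 'k mpol) \<in> homogeneous_part n 0"
        using is_hom_const[of 1] by (simp add: homogeneous_part_iff pol_carrier_simps const_pol_simps)
      ultimately have "card {1 :: 'k mpol} = hdim n (UNIV :: 'k mpol set) 0"
        unfolding hdim_def by (intro mp.basis_card_eq_dim) auto
      then show ?thesis by simp
    qed
    ultimately show "fps_nth (hser n (idl n ?F)) d = fps_nth 1 d"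
      by (simp add: hser_def)
  qed
  ultimately show ?thesis by simp
qed

section \<open>Growing a graph\<close>

definition bin :: "nat \<Rightarrow> nat \<Rightarrow> 'k::field mpol" where
  "bin i j = xvar i * yvar j - xvar j * yvar i"

text \<open>Both orientations of an edge occur; they differ by a sign. This removes the order of the
  vertices from all arguments about graphs.\<close>

definition gens :: "nat set set \<Rightarrow> 'k::field mpol set" where
  "gens E = {bin i j |i j. {i, j} \<in> E}"

lemma bin_swap: "bin j i = - bin i j"
  by (simp add: bin_def)

lemma gens_Un: "gens (E \<union> E') = gens E \<union> gens E'"
  by (auto simp: gens_def)

lemma gens_empty [simp]: "gens {} = {}"
  by (simp add: gens_def)

lemma gens_insert: "gens (insert {u, v} E) = insert (bin u v) (insert (bin v u) (gens E))"
  by (auto simp: gens_def doubleton_eq_iff)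

lemma idl_insert_bin_swap: "idl n (insert (bin u v) (insert (bin v u) F)) = idl n (insert (bin u v) F)"
proof (rule idl_eqI)
  have "bin v u \<in> idl n (insert (bin u v) F)"
    using idl_uminus[OF idl_base[of "bin u v" "insert (bin u v) F"]] by (simp add: bin_swap[of v u])
  then show "insert (bin u v) (insert (bin v u) F) \<subseteq> idl n (insert (bin u v) F)"
    by (auto intro: idl_base)
qed (auto intro: idl_base)

lemma idl_gens_insert:
  "idl n (F \<union> gens (insert {u, v} E)) = idl n (insert (bin u v) (F \<union> gens E))"
  using idl_insert_bin_swap[of n u v "F \<union> gens E"] by (simp add: gens_insert)

lemma idl_Un_cong: "idl n F = idl n G \<Longrightarrow> idl n (F \<union> H) = idl n (G \<union> H)"
proof (rule idl_eqI)
  assume eq: "idl n F = idl n G"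
  have "F \<subseteq> idl n G" "G \<subseteq> idl n F" unfolding eq[symmetric] using eq by (auto intro: idl_base)
  then show "F \<union> H \<subseteq> idl n (G \<union> H)" "G \<union> H \<subseteq> idl n (F \<union> H)"
    using idl_mono[of G "G \<union> H" n] idl_mono[of F "F \<union> H" n] by (auto intro: idl_base)
qed

lemma idl_insert_cong: "idl n F = idl n G \<Longrightarrow> idl n (insert g F) = idl n (insert g G)"
  using idl_Un_cong[of n F G "{g}"] by simp

lemma xvar_carrier: "xvar i \<in> pol_carrier n \<longleftrightarrow> i \<in> {1..n}"
  and yvar_carrier: "yvar i \<in> pol_carrier n \<longleftrightarrow> i \<in> {1..n}"
  unfolding xvar_eq yvar_eq pol_carrier_mvar by auto

lemma bin_carrier: "i \<in> {1..n} \<Longrightarrow> j \<in> {1..n} \<Longrightarrow> bin i j \<in> pol_carrier n"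
  by (simp add: bin_def xvar_carrier yvar_carrier pol_carrier_intros)

lemma is_hom_xvar: "is_hom 1 (xvar i)" by (simp add: xvar_eq is_hom_mvar)

lemma is_hom_bin: "is_hom 2 (bin i j)"
  unfolding bin_def xvar_eq yvar_eq one_add_one[symmetric]
  by (intro is_hom_diff is_hom_mult is_hom_mvar(1))

lemma hom_gens_gens: "\<Union>E \<subseteq> {1..n} \<Longrightarrow> hom_gens n (gens E)"
  unfolding hom_gens_def gens_def using bin_carrier is_hom_bin by blast

lemma hom_gens_Un: "hom_gens n (F \<union> G) \<longleftrightarrow> hom_gens n F \<and> hom_gens n G"
  by (auto simp: hom_gens_def)

definition vfresh :: "nat \<Rightarrow> 'k::field mpol set \<Rightarrow> bool" where
  "vfresh v F \<longleftrightarrow> fresh (XVar v) F \<and> fresh (YVar v) F"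

lemma avoids_bin:
  "v \<noteq> i \<Longrightarrow> v \<noteq> j \<Longrightarrow> avoids (XVar v) (bin i j)"
  "v \<noteq> i \<Longrightarrow> v \<noteq> j \<Longrightarrow> avoids (YVar v) (bin i j)"
  by (simp_all add: bin_def xvar_eq yvar_eq avoids_diff avoids_mult avoids_mvar)

lemma vfresh_empty [simp]: "vfresh v {}" by (simp add: vfresh_def)

lemma vfresh_Un: "vfresh v (F \<union> G) \<longleftrightarrow> vfresh v F \<and> vfresh v G"
  by (auto simp: vfresh_def fresh_Un)

lemma vfresh_insert_bin: "v \<noteq> i \<Longrightarrow> v \<noteq> j \<Longrightarrow> vfresh v F \<Longrightarrow> vfresh v (insert (bin i j) F)"
  by (simp add: vfresh_def fresh_insert avoids_bin)

lemma vfresh_insert_xvar: "v \<noteq> i \<Longrightarrow> vfresh v F \<Longrightarrow> vfresh v (insert (xvar i) F)"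
  by (simp add: vfresh_def fresh_insert xvar_eq avoids_mvar)

lemma vfresh_gens: "v \<notin> \<Union>E \<Longrightarrow> vfresh v (gens E)"
  unfolding vfresh_def fresh_def gens_def using avoids_bin by blast

lemma nzd_xvar_vfresh: "vfresh v F \<Longrightarrow> nzd n F (xvar v)"
  by (simp add: vfresh_def xvar_eq nzd_fresh)

text \<open>The two binomial lemmas with \<open>a\<close>, \<open>b\<close> the variables of
  \<open>u\<close> and \<open>c\<close>, \<open>d\<close> those of the new vertex. The second
  conclusion hands the hypothesis on \<open>xvar u\<close> over to \<open>v\<close>.\<close>

lemma leaf_nzd:
  assumes F: "hom_gens n F" and v: "vfresh v F" and uv: "u \<noteq> v" "u \<in> {1..n}" "v \<in> {1..n}"
    and nz: "nzd n F (xvar u)"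
  shows "nzd n F (bin u v)" "nzd n (insert (bin u v) F) (xvar v)"
proof -
  have *: "fresh (XVar v) F" "fresh (YVar v) F" "nzd n F (xvar u)" "avoids (XVar v) (xvar u)"
    "XVar v \<noteq> YVar v" "F \<subseteq> pol_carrier n" "xvar u \<in> pol_carrier n" "yvar u \<in> pol_carrier n"
    "mvar (XVar v) \<in> pol_carrier n" "mvar (YVar v) \<in> pol_carrier n"
    using assms
    by (auto simp: vfresh_def xvar_eq yvar_eq avoids_mvar hom_gens_def pol_carrier_mvar)
  show "nzd n F (bin u v)" "nzd n (insert (bin u v) F) (xvar v)"
    using nzd_binomial[OF *] nzd_new_var[OF *] by (simp_all add: bin_def xvar_eq yvar_eq)
qed

lemma nzd_empty_bin: "u \<noteq> v \<Longrightarrow> u \<in> {1..n} \<Longrightarrow> v \<in> {1..n} \<Longrightarrow> nzd n {} (bin u v)"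
  by (intro leaf_nzd nzd_xvar_vfresh) simp_all

lemma hser_insert_bin:
  assumes "hom_gens n F" "u \<noteq> v" "u \<in> {1..n}" "v \<in> {1..n}" "nzd n F (bin u v)"
  shows "hser n (idl n (insert (bin u v) F)) = (1 - fps_X\<^sup>2) * hser n (idl n F)"
  using assms by (intro hser_nzd bin_carrier is_hom_bin nzd_empty_bin)

lemma hser_insert_xvar:
  assumes "hom_gens n F" "v \<in> {1..n}" "nzd n F (xvar v)"
  shows "hser n (idl n (insert (xvar v) F)) = (1 - fps_X) * hser n (idl n F)"
  using hser_nzd[OF assms(1) _ is_hom_xvar nzd_xvar_vfresh assms(3)] assms(2)
  by (simp add: xvar_carrier)

section \<open>Attaching paths and triangles\<close>

fun pedges :: "'a list \<Rightarrow> 'a set set" where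
  "pedges (a # b # l) = insert {a, b} (pedges (b # l))"
| "pedges _ = {}"

lemma pedges_Cons: "l \<noteq> [] \<Longrightarrow> pedges (a # l) = insert {a, hd l} (pedges l)"
  by (cases l) auto

lemma pedges_append:
  "xs \<noteq> [] \<Longrightarrow> ys \<noteq> [] \<Longrightarrow> pedges (xs @ ys) = insert {last xs, hd ys} (pedges xs \<union> pedges ys)"
  by (induct xs rule: pedges.induct) (auto simp: pedges_Cons)

lemma pedges_rev: "pedges (rev xs) = pedges xs"
proof (induct xs)
  case (Cons a xs)
  then show ?case
    by (cases "xs = []") (simp_all add: pedges_append pedges_Cons last_rev insert_commute)
qed simp

lemma Union_pedges: "\<Union>(pedges xs) \<subseteq> set xs"
  by (induct xs rule: pedges.induct) auto

text \<open>\<open>F\<close> is generalized in the induction because it absorbs each edge after its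
  attachment. The statement about the last vertex allows growth to continue there.\<close>

lemma path_grow:
  assumes "hom_gens n F" "nzd n F (xvar u)" "distinct (u # ws)" "set (u # ws) \<subseteq> {1..n}"
    "\<And>w. w \<in> set ws \<Longrightarrow> vfresh w F"
  shows "hser n (idl n (F \<union> gens (pedges (u # ws)))) = (1 - fps_X\<^sup>2) ^ length ws * hser n (idl n F)
    \<and> nzd n (F \<union> gens (pedges (u # ws))) (xvar (last (u # ws)))"
  using assms
proof (induct ws arbitrary: u F)
  case (Cons w ws)
  let ?F = "insert (bin u w) F"
  have u: "u \<noteq> w" "u \<in> {1..n}" "w \<in> {1..n}" "vfresh w F" using Cons.prems by auto
  note l = leaf_nzd[OF Cons.prems(1) u(4,1-3) Cons.prems(2)]
  have "hom_gens n ?F"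
    using Cons.prems(1) u is_hom_bin by (auto simp: hom_gens_insert intro: bin_carrier)
  moreover have "vfresh z ?F" if "z \<in> set ws" for z
    using that Cons.prems by (intro vfresh_insert_bin) auto
  ultimately have IH: "hser n (idl n (?F \<union> gens (pedges (w # ws))))
      = (1 - fps_X\<^sup>2) ^ length ws * hser n (idl n ?F)"
    "nzd n (?F \<union> gens (pedges (w # ws))) (xvar (last (w # ws)))"
    using Cons.hyps[of ?F w] Cons.prems l(2) by auto
  have eq: "idl n (F \<union> gens (pedges (u # w # ws))) = idl n (?F \<union> gens (pedges (w # ws)))"
    using idl_gens_insert[of n F u w "pedges (w # ws)"] by simp
  show ?case
    using IH hser_insert_bin[OF Cons.prems(1) u(1-3) l(1)] nzd_cong[OF eq]
    by (simp add: eq mult.assoc mult.left_commute del: pedges.simps)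
qed simp

text \<open>A path disjoint from \<open>F\<close> can start anywhere, since the x-variable of a new
  vertex is always a nonzerodivisor. Growing it from its far end leaves the head as the last vertex
  and gives the property there.\<close>

lemma path_fresh:
  assumes "hom_gens n F" "ws \<noteq> []" "distinct ws" "set ws \<subseteq> {1..n}"
    "\<And>w. w \<in> set ws \<Longrightarrow> vfresh w F"
  shows "hser n (idl n (F \<union> gens (pedges ws))) = (1 - fps_X\<^sup>2) ^ (length ws - 1) * hser n (idl n F)"
    and "nzd n (F \<union> gens (pedges ws)) (xvar (hd ws))"
proof -
  obtain w l where wl: "rev ws = w # l" using assms(2) by (cases "rev ws") auto
  have st: "set ws = set (w # l)" "distinct (w # l)" "length ws - 1 = length l" "hd ws = last (w # l)"
    using wl assms(2,3)
    by (metis set_rev, metis distinct_rev, metis length_rev length_Cons diff_Suc_1, metis last_rev)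
  have pe: "pedges ws = pedges (w # l)" using pedges_rev[of ws] wl by simp
  have fr: "z \<in> set l \<Longrightarrow> vfresh z F" "vfresh w F" for z using assms(5) st(1) by auto
  show "hser n (idl n (F \<union> gens (pedges ws))) = (1 - fps_X\<^sup>2) ^ (length ws - 1) * hser n (idl n F)"
    and "nzd n (F \<union> gens (pedges ws)) (xvar (hd ws))"
    using path_grow[OF assms(1) nzd_xvar_vfresh[OF fr(2)] st(2) _ fr(1)] assms(4) st pe
    by auto
qed

text \<open>Expansions of vanishing 3 by 3 determinants: two rows are those of the variables x and y
  at \<open>a\<close>, \<open>u\<close>, \<open>b\<close>, and the third repeats one of
  them.\<close>

lemma bin_triangle:
  "xvar u * bin a b = xvar a * bin u b + xvar b * bin a u"
  "yvar u * bin a b = yvar a * bin u b + yvar b * bin a u"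
  by (simp_all add: bin_def algebra_simps)

lemma triangle_in_colon:
  assumes "bin a u \<in> idl n F" "bin u b \<in> idl n F" "{a, u, b} \<subseteq> {1..n}"
  shows "xvar u * bin a b \<in> idl n F" "yvar u * bin a b \<in> idl n F"
proof -
  have S: "xvar a \<in> pol_carrier n" "xvar b \<in> pol_carrier n" "yvar a \<in> pol_carrier n"
    "yvar b \<in> pol_carrier n"
    using assms(3) by (simp_all add: xvar_carrier yvar_carrier)
  show "xvar u * bin a b \<in> idl n F"
    by (subst bin_triangle) (intro idl_add idl_mult assms S)
  show "yvar u * bin a b \<in> idl n F"
    by (subst bin_triangle) (intro idl_add idl_mult assms S)
qed

text \<open>Setting both variables of \<open>u\<close> to zero annihilates the binomials of the two
  edges at \<open>u\<close> and fixes \<open>bin a b\<close>. A relation thus reduces to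
  \<open>bin a b\<close> times the part of \<open>h\<close> free of these variables, which lies in
  the ideal of \<open>F\<close> by \<open>nz\<close>. The other inclusion is the determinant
  identity.\<close>

lemma colon_triangle:
  assumes F: "hom_gens n F" and u: "vfresh u F" "u \<noteq> a" "u \<noteq> b" "{a, u, b} \<subseteq> {1..n}"
    and nz: "nzd n F (bin a b)"
  shows "colon n (insert (bin a u) (insert (bin u b) F)) (bin a b)
    = idl n (mvar ` {XVar u, YVar u} \<union> F)" (is "colon n ?P _ = idl n ?Q")
proof
  have abS: "bin a b \<in> pol_carrier n" and QS: "?Q \<subseteq> pol_carrier n"
    using u(4) F bin_carrier xvar_carrier[of u n] yvar_carrier[of u n]
    by (auto simp: hom_gens_def xvar_eq yvar_eq)
  show "idl n ?Q \<subseteq> colon n ?P (bin a b)"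
  proof
    fix h assume h: "h \<in> idl n ?Q"
    have gen: "f * bin a b \<in> idl n ?P" if "f \<in> ?Q" for f
    proof -
      have "f \<in> F \<or> f = xvar u \<or> f = yvar u" using that by (auto simp: xvar_eq yvar_eq)
      then show ?thesis
      proof (elim disjE)
        assume "f \<in> F"
        then show ?thesis using abS by (intro idl_mult_right idl_base) auto
      qed (use triangle_in_colon[of a u n ?P b] u(4) in \<open>auto intro: idl_base\<close>)
    qed
    from h have "h * bin a b \<in> idl n ?P"
    proof induct
      case (step f q p)
      then have "q * (f * bin a b) + p * bin a b \<in> idl n ?P"
        by (intro idl_add[OF idl_mult[OF gen[OF step(1)] step(2)] step(4)])
      then show ?case by (simp add: distrib_right mult.assoc)
    qed (simp add: idl.zero)
    with h show "h \<in> colon n ?P (bin a b)"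
      using idl_carrier[OF QS] by (auto simp: colon_def mult.commute)
  qed
  show "colon n ?P (bin a b) \<subseteq> idl n ?Q"
  proof
    fix h assume "h \<in> colon n ?P (bin a b)"
    then have h: "h \<in> pol_carrier n" "bin a b * h \<in> idl n ?P" by (simp_all add: colon_def)
    then obtain j p q where j: "j \<in> idl n F" "p \<in> pol_carrier n" "q \<in> pol_carrier n"
      "bin a b * h = j + bin u b * p + bin a u * q"
      by (elim idl_insertE) auto
    define K where "K = (\<lambda>p :: 'a mpol. kill (YVar u) (kill (XVar u) p))"
    have Kab: "K (bin a b) = bin a b"
      using u by (simp add: K_def kill_avoids avoids_bin)
    have K0: "K (bin u b) = 0" "K (bin a u) = 0"
      by (simp_all add: K_def bin_def xvar_eq yvar_eq kill_diff kill_uminus kill_mult kill_mvar)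
    have "K (bin a b * h) \<in> idl n F"
      unfolding j(4) using j(1) u(1) K0
      by (simp add: K_def kill_add kill_mult vfresh_def idl_kill)
    then have "bin a b * K h \<in> idl n F" using Kab by (simp add: K_def kill_mult)
    then have "K h \<in> idl n F"
      by (rule nzdD[OF nz]) (unfold K_def, intro pol_carrier_kill h)
    then have "K h \<in> idl n ?Q" using idl_mono[of F ?Q n] by auto
    moreover have "mvar (YVar u) * shift (YVar u) (kill (XVar u) h) \<in> idl n ?Q"
      "mvar (XVar u) * shift (XVar u) h \<in> idl n ?Q"
      by (rule idl_mult_right[OF idl_base], simp, intro pol_carrier_shift pol_carrier_kill h)+
    ultimately have "K h + mvar (YVar u) * shift (YVar u) (kill (XVar u) h)
        + mvar (XVar u) * shift (XVar u) h \<in> idl n ?Q" by (intro idl_add)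
    then show "h \<in> idl n ?Q"
      using kill_split[of h "XVar u"] kill_split[of "kill (XVar u) h" "YVar u"]
      by (simp add: K_def)
  qed
qed

text \<open>The syzygies of \<open>x\<^sub>a, x\<^sub>b\<close> modulo the ideal and the edge \<open>a b\<close> are generated by
  \<open>(x\<^sub>b, -x\<^sub>a)\<close> and \<open>(y\<^sub>b, -y\<^sub>a)\<close>, and both turn \<open>(f\<^sub>u\<^sub>a, f\<^sub>u\<^sub>b)\<close> into multiples of \<open>f\<^sub>a\<^sub>b\<close>.\<close>

lemma nzd_cone:
  assumes F: "hom_gens n F" and u: "vfresh u F" "u \<noteq> a" "u \<noteq> b" "{a, u, b} \<subseteq> {1..n}"
    and nza: "nzd n F (xvar a)" and nzb: "nzd n (insert (xvar a) F) (xvar b)"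
  shows "nzd n (insert (bin u a) (insert (bin u b) (insert (bin a b) F))) (xvar u)"
  unfolding nzd_def
proof (intro ballI impI)
  let ?J = "insert (bin a b) F" and ?X = "XVar u"
  let ?T = "insert (bin u a) (insert (bin u b) ?J)"
  have S: "xvar a \<in> pol_carrier n" "yvar a \<in> pol_carrier n" "xvar b \<in> pol_carrier n"
    "yvar b \<in> pol_carrier n" "xvar u \<in> pol_carrier n" "yvar u \<in> pol_carrier n"
    "bin u a \<in> pol_carrier n" "bin u b \<in> pol_carrier n"
    using u(4) by (auto simp: xvar_carrier yvar_carrier intro: bin_carrier)
  have frJ: "fresh ?X ?J" "fresh (YVar u) ?J"
    using vfresh_insert_bin[OF u(2,3,1)] by (auto simp: vfresh_def)
  have FJ: "idl n F \<subseteq> idl n ?J" by (intro idl_mono) auto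
  have ab: "r * bin a b \<in> idl n ?J" if "r \<in> pol_carrier n" for r
    using that by (intro idl_mult idl_base) auto
  fix h assume h: "h \<in> pol_carrier n" "xvar u * h \<in> idl n ?T"
  then obtain j q p where jpq: "j \<in> idl n ?J" "q \<in> pol_carrier n" "p \<in> pol_carrier n"
    "xvar u * h = j + bin u b * q + bin u a * p"
    by (elim idl_insertE[of _ n "bin u a"] idl_insertE[of _ n "bin u b"]) auto
  define p0 p1 q0 q1 where "p0 = kill ?X p" "p1 = shift ?X p" "q0 = kill ?X q" "q1 = shift ?X q"
  note defs = this
  have pq: "p0 \<in> pol_carrier n" "p1 \<in> pol_carrier n" "q0 \<in> pol_carrier n" "q1 \<in> pol_carrier n"
    using jpq by (simp_all add: defs pol_carrier_kill pol_carrier_shift)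
  have p: "p = p0 + xvar u * p1" and q: "q = q0 + xvar u * q1"
    unfolding defs xvar_eq by (rule kill_split)+
  \<comment> \<open>At \<open>xvar u = 0\<close> the binomials \<open>bin u a\<close> and
    \<open>bin u b\<close> become \<open>- xvar a * yvar u\<close> and
    \<open>- xvar b * yvar u\<close>. After cancelling \<open>yvar u\<close>, the relation is a
    syzygy of \<open>xvar a\<close> and \<open>xvar b\<close>.\<close>
  have "kill ?X (xvar u * h) = 0" by (simp add: kill_mult xvar_eq kill_mvar)
  then have "kill ?X j - yvar u * (xvar a * p0 + xvar b * q0) = 0"
    unfolding jpq(4) using u(2,3)
    by (simp add: kill_add kill_mult kill_diff bin_def xvar_eq yvar_eq kill_mvar defs algebra_simps)
  moreover have "kill ?X j \<in> idl n ?J" using frJ jpq(1) by (intro idl_kill)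
  ultimately have "yvar u * (xvar a * p0 + xvar b * q0) \<in> idl n ?J" by simp
  then have "xvar a * p0 + xvar b * q0 \<in> idl n ?J"
    unfolding yvar_eq by (rule nzdD[OF nzd_fresh[OF frJ(2)]]) (intro pol_carrier_intros S pq)
  then obtain i c where ic: "i \<in> idl n F" "c \<in> pol_carrier n"
    "xvar a * p0 + xvar b * q0 = i + bin a b * c" by (elim idl_insertE)
  then have syz: "i = xvar a * (p0 - c * yvar b) + xvar b * (q0 + c * yvar a)"
    by (simp add: bin_def algebra_simps)
  \<comment> \<open>Modulo \<open>xvar a\<close> only the term with \<open>xvar b\<close> survives,
    and \<open>xvar b\<close> is a nonzerodivisor there.\<close>
  have "i + xvar a * (- (p0 - c * yvar b)) \<in> idl n (insert (xvar a) F)"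
    using ic S pq by (intro idl_insertI pol_carrier_intros)
  also have "i + xvar a * (- (p0 - c * yvar b)) = xvar b * (q0 + c * yvar a)"
    by (simp add: syz algebra_simps)
  finally have "q0 + c * yvar a \<in> idl n (insert (xvar a) F)"
    by (rule nzdD[OF nzb]) (intro pol_carrier_intros S pq ic)
  then obtain i2 d where d: "i2 \<in> idl n F" "d \<in> pol_carrier n" "q0 + c * yvar a = i2 + xvar a * d"
    by (elim idl_insertE)
  define i3 where "i3 = p0 - c * yvar b + xvar b * d"
  have "i - xvar b * i2 \<in> idl n F" using ic d S by (intro idl_diff idl_mult)
  also have "i - xvar b * i2 = xvar a * i3"
    unfolding syz d(3) i3_def by (simp add: algebra_simps)
  finally have i3: "i3 \<in> idl n F"
    by (rule nzdD[OF nza]) (unfold i3_def, intro pol_carrier_intros S pq ic d)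
  have p0: "p0 = i3 + c * yvar b - xvar b * d" and q0: "q0 = i2 + xvar a * d - c * yvar a"
    using d(3) by (simp_all add: i3_def algebra_simps)
  have "bin u a * p0 + bin u b * q0
      = bin u a * i3 + bin u b * i2 + (xvar u * d - yvar u * c) * bin a b"
    unfolding p0 q0 by (simp add: bin_def algebra_simps)
  also have "\<dots> \<in> idl n ?J"
    using i3 d ic S FJ by (intro idl_add idl_mult ab pol_carrier_intros) auto
  finally have "bin u a * p0 + bin u b * q0 \<in> idl n ?J" .
  from idl_add[OF jpq(1) this] have "j + (bin u a * p0 + bin u b * q0) \<in> idl n ?J" .
  also have "j + (bin u a * p0 + bin u b * q0) = xvar u * (h - bin u a * p1 - bin u b * q1)"
    using jpq(4) by (simp add: p q algebra_simps)
  finally have "h - bin u a * p1 - bin u b * q1 \<in> idl n ?J"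
    unfolding xvar_eq[of u]
    by (rule nzdD[OF nzd_fresh[OF frJ(1)]]) (intro pol_carrier_intros S pq h)
  then have "h - bin u a * p1 - bin u b * q1 + bin u b * q1 + bin u a * p1 \<in> idl n ?T"
    using pq by (intro idl_insertI)
  then show "h \<in> idl n ?T" by simp
qed

text \<open>Repeated use turns an explicit edge set into nested insertions of single binomials, in
  the order and orientation that a particular argument asks for.\<close>

lemma idl_gens_insertI:
  "idl n (F \<union> gens E) = idl n G \<Longrightarrow> idl n (F \<union> gens (insert {u, v} E)) = idl n (insert (bin u v) G)"
  by (rule trans[OF idl_gens_insert idl_insert_cong])

text \<open>The apex \<open>u\<close> has no neighbours besides \<open>a\<close> and the head of
  \<open>ws\<close>. All ideals compared here are grown from \<open>F\<close> by paths, so each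
  nonzerodivisor required follows by counting. The second conclusion is what allows growth beyond
  the apex.\<close>

lemma cone:
  fixes F :: "'k::field mpol set"
  assumes F: "hom_gens n F" and nz: "nzd n F (xvar a)" and ws: "ws \<noteq> []"
    and dist: "distinct (a # u # ws)" and S: "set (a # u # ws) \<subseteq> {1..n}"
    and fr: "\<And>w. w \<in> set (u # ws) \<Longrightarrow> vfresh w F"
    and E: "E = {{a, hd ws}, {a, u}, {u, hd ws}} \<union> pedges ws"
  shows "hser n (idl n (F \<union> gens E))
      = (1 - fps_X\<^sup>2) ^ (length ws - 1) * (1 - fps_X)\<^sup>2 * (1 + 2 * fps_X) * hser n (idl n F)"
    and "nzd n (F \<union> gens E) (xvar u)"
proof -
  define J where "J = F \<union> gens (pedges ws)"
  define b where "b = hd ws"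
  define k where "k = length ws - 1"
  let ?P = "insert (bin a u) (insert (bin u b) J)" and ?H = "hser n (idl n F)"
  have len: "length ws = Suc k" using ws by (cases ws) (auto simp: k_def)
  have b: "b \<in> set ws" using ws by (simp add: b_def)
  then have ab: "a \<noteq> b" "u \<noteq> a" "u \<noteq> b" "{a, u, b} \<subseteq> {1..n}" and aS: "a \<in> {1..n}" and bS: "b \<in> {1..n}"
    using dist S by auto
  have vars: "\<Union>(pedges ws) \<subseteq> {1..n}" using Union_pedges[of ws] S by auto
  have homJ: "hom_gens n J" unfolding J_def hom_gens_Un using F hom_gens_gens[OF vars] by blast
  have uJ: "vfresh u J"
    unfolding J_def vfresh_Un using fr dist Union_pedges[of ws] by (auto intro: vfresh_gens)
  have hJ: "hser n (idl n J) = (1 - fps_X\<^sup>2) ^ k * ?H"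
    unfolding J_def k_def by (rule path_fresh(1)) (use F ws dist S fr in auto)
  have xF: "hom_gens n (insert (xvar a) F)"
    using F ab is_hom_xvar by (auto simp: hom_gens_insert xvar_carrier)
  have xfr: "w \<in> set ws \<Longrightarrow> vfresh w (insert (xvar a) F)" for w
    using fr dist by (intro vfresh_insert_xvar) auto
  have pf: "ws \<noteq> []" "distinct ws" "set ws \<subseteq> {1..n}" using ws dist S by auto
  have nzb: "nzd n (insert (xvar a) J) (xvar b)"
    using path_fresh(2)[OF xF pf xfr] by (simp add: J_def b_def)
  \<comment> \<open>The path \<open>ws\<close> does not touch \<open>a\<close>, so it multiplies the
    series by the same factor whether or not \<open>xvar a\<close> has been adjoined. Hence
    \<open>xvar a\<close> remains a nonzerodivisor modulo \<open>J\<close>.\<close>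
  have "hser n (idl n (insert (xvar a) J)) = (1 - fps_X\<^sup>2) ^ k * hser n (idl n (insert (xvar a) F))"
    using path_fresh(1)[OF xF pf xfr] by (simp add: J_def k_def)
  then have "hser n (idl n (insert (xvar a) J)) = (1 - fps_X ^ 1) * hser n (idl n J)"
    using hser_insert_xvar[OF F aS nz] by (simp add: hJ)
  then have nza: "nzd n J (xvar a)"
    using ab by (intro nzd_hser[OF homJ _ is_hom_xvar] nzd_xvar_vfresh) (simp_all add: xvar_carrier)
  have eT: "idl n (F \<union> gens E) = idl n (insert (bin u a) (insert (bin u b) (insert (bin a b) J)))"
  proof -
    have E': "E = insert {u, a} (insert {u, b} (insert {a, b} (pedges ws)))"
      unfolding E b_def by (auto simp: insert_commute)
    show ?thesis unfolding E' by (intro idl_gens_insertI) (simp add: J_def)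
  qed
  show "nzd n (F \<union> gens E) (xvar u)"
    using nzd_cone[OF homJ uJ ab(2-4) nza nzb] nzd_cong[OF eT] by blast
  \<comment> \<open>The edge from \<open>a\<close> to \<open>b\<close> joins two existing pieces of
    \<open>J\<close>. Growing \<open>a # ws\<close> from \<open>a\<close> gives the series with that
    edge and shows that its binomial is a nonzerodivisor.\<close>
  have "idl n (F \<union> gens (pedges (a # ws))) = idl n (insert (bin a b) J)"
    unfolding pedges_Cons[OF ws] b_def by (intro idl_gens_insertI) (simp add: J_def)
  moreover have "hser n (idl n (F \<union> gens (pedges (a # ws)))) = (1 - fps_X\<^sup>2) ^ length ws * ?H"
    by (rule path_grow[OF F nz, THEN conjunct1]) (use dist S fr in auto)
  ultimately have "hser n (idl n (insert (bin a b) J)) = (1 - fps_X\<^sup>2) * hser n (idl n J)"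
    by (simp add: hJ len mult.assoc)
  then have nzab: "nzd n J (bin a b)"
    using ab aS bS
    by (intro nzd_hser[OF homJ _ is_hom_bin] nzd_empty_bin bin_carrier)
  \<comment> \<open>Without its side from \<open>a\<close> to \<open>b\<close> the triangle is
    opened to a path through \<open>u\<close>.\<close>
  have "idl n (F \<union> gens (pedges (a # u # ws))) = idl n ?P"
    unfolding pedges.simps(1) pedges_Cons[OF ws] b_def by (intro idl_gens_insertI) (simp add: J_def)
  moreover have "hser n (idl n (F \<union> gens (pedges (a # u # ws))))
      = (1 - fps_X\<^sup>2) ^ length (u # ws) * ?H"
    by (rule path_grow[OF F nz, THEN conjunct1]) (use dist S fr in auto)
  ultimately have hP: "hser n (idl n ?P) = (1 - fps_X\<^sup>2) ^ (k + 2) * ?H"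
    by (simp add: len)
  have homP: "hom_gens n ?P"
    using homJ ab(4) is_hom_bin by (auto simp: hom_gens_insert intro!: bin_carrier)
  have eT': "idl n (F \<union> gens E) = idl n (insert (bin a b) ?P)"
  proof -
    have E': "E = insert {a, b} (insert {a, u} (insert {u, b} (pedges ws)))"
      unfolding E b_def by (auto simp: insert_commute)
    show ?thesis unfolding E' by (intro idl_gens_insertI) (simp add: J_def)
  qed
  have "hser n (idl n (mvar ` {XVar u, YVar u} \<union> J))
      = (1 - fps_X) ^ card {XVar u, YVar u} * hser n (idl n J)"
    using ab(4) uJ homJ by (intro hser_mvars[THEN conjunct1]) (auto simp: vfresh_def)
  then have hc: "hser n (colon n ?P (bin a b)) = (1 - fps_X)\<^sup>2 * ((1 - fps_X\<^sup>2) ^ k * ?H)"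
    by (simp add: colon_triangle[OF homJ uJ ab(2-4) nzab] hJ numeral_2_eq_2)
  have "hser n (idl n (F \<union> gens E)) = hser n (idl n ?P) - fps_X\<^sup>2 * hser n (colon n ?P (bin a b))"
    unfolding eT' using ab aS bS
    by (intro hser_insert homP bin_carrier is_hom_bin nzd_empty_bin)
  \<comment> \<open>With t for \<open>fps_X\<close>, the factor \<open>1 + 2 * t\<close> arises as
    \<open>(1 + t)^2 - t^2\<close>, after \<open>(1 - t)^2\<close> is taken out.\<close>
  also have "\<dots> = (1 - fps_X\<^sup>2) ^ k * (1 - fps_X)\<^sup>2 * (1 + 2 * fps_X) * ?H"
    unfolding hP hc power_add by (simp add: power2_eq_square algebra_simps)
  finally show "hser n (idl n (F \<union> gens E))
      = (1 - fps_X\<^sup>2) ^ (length ws - 1) * (1 - fps_X)\<^sup>2 * (1 + 2 * fps_X) * ?H"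
    by (simp only: k_def)
qed

text \<open>\<open>cone\<close> over \<open>v\<close> with apex the head of \<open>ds\<close>
  attaches the triangle and the path \<open>cs\<close>; the rest of \<open>ds\<close> then grows
  from the apex.\<close>

lemma triangle_grow:
  fixes F :: "'k::field mpol set"
  assumes F: "hom_gens n F" and nz: "nzd n F (xvar v)" and ne: "cs \<noteq> []" "ds \<noteq> []"
    and dist: "distinct (v # cs @ ds)" and S: "set (v # cs @ ds) \<subseteq> {1..n}"
    and fr: "\<And>w. w \<in> set (cs @ ds) \<Longrightarrow> vfresh w F"
    and E: "E = {{v, hd cs}, {v, hd ds}, {hd cs, hd ds}} \<union> pedges cs \<union> pedges ds"
  shows "hser n (idl n (F \<union> gens E)) = (1 - fps_X\<^sup>2) ^ (length cs + length ds - 2)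
    * (1 - fps_X)\<^sup>2 * (1 + 2 * fps_X) * hser n (idl n F)"
proof -
  obtain d ds' where ds: "ds = d # ds'" using ne by (cases ds) auto
  define E1 where "E1 = {{v, hd cs}, {v, d}, {d, hd cs}} \<union> pedges cs"
  let ?F = "F \<union> gens E1"
  have c: "distinct (v # d # cs)" "set (v # d # cs) \<subseteq> {1..n}"
    "\<And>w. w \<in> set (d # cs) \<Longrightarrow> vfresh w F"
    using dist S fr by (auto simp: ds)
  note cone = cone[OF F nz ne(1) c E1_def]
  have E1: "\<Union>E1 \<subseteq> set (v # d # cs)"
    using Union_pedges[of cs] ne by (auto simp: E1_def)
  then have "hom_gens n (gens E1 :: 'k mpol set)" using c by (intro hom_gens_gens) blast
  then have hF: "hom_gens n ?F" using F by (simp add: hom_gens_Un)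
  have fr': "vfresh w ?F" if "w \<in> set ds'" for w
    unfolding vfresh_Un using that fr dist E1 by (auto simp: ds intro!: vfresh_gens)
  have "hser n (idl n (?F \<union> gens (pedges (d # ds'))))
      = (1 - fps_X\<^sup>2) ^ length ds' * hser n (idl n ?F)"
    using path_grow[OF hF cone(2) _ _ fr'] dist S by (simp add: ds)
  moreover have "?F \<union> gens (pedges (d # ds')) = F \<union> gens E"
    unfolding Un_assoc gens_Un[symmetric]
    by (rule arg_cong[where f = "\<lambda>E. F \<union> gens E"]) (auto simp: E E1_def ds insert_commute)
  moreover have "length cs + length ds - 2 = length ds' + (length cs - 1)"
    using ne by (cases cs) (simp_all add: ds)
  ultimately show ?thesis using cone(1) by (simp add: power_add mult.assoc)
qed

section \<open>Adding the edge between two components\<close>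

lemma colon_eqI:
  assumes "hom_gens n F0" "F \<subseteq> colon n F0 f" "F0 \<subseteq> F" "nzd n F f" "f \<in> pol_carrier n"
  shows "colon n F0 f = idl n F"
proof
  show "idl n F \<subseteq> colon n F0 f"
  proof
    fix p assume "p \<in> idl n F"
    then show "p \<in> colon n F0 f"
    proof induct
      case (step g q p)
      then have "g \<in> colon n F0 f" using assms(2) by blast
      then have g: "g \<in> pol_carrier n" "f * g \<in> idl n F0" by (simp_all add: colon_def)
      have "q * (f * g) + f * p \<in> idl n F0"
        using step(4) by (intro idl_add[OF idl_mult[OF g(2) step(2)]]) (simp add: colon_def)
      then show ?case
        using step g by (simp add: colon_def pol_carrier_intros distrib_left mult.left_commute)
    qed (simp add: colon_def pol_carrier_simps idl.zero)
  qed
  show "colon n F0 f \<subseteq> idl n F"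
    using idl_mono[OF assms(3), of n] nzdD[OF assms(4)] by (auto simp: colon_def)
qed

text \<open>The edges in \<open>E1\<close> join two neighbours of \<open>u\<close> or two neighbours
  of \<open>v\<close>, so their binomials lie in the colon ideal of \<open>bin u v\<close>. The
  equation of series makes \<open>bin u v\<close> a nonzerodivisor once they are adjoined, hence
  they exhaust the colon ideal.\<close>

lemma hser_bridge:
  fixes F :: "'k::field mpol set" and E0 E1 :: "nat set set"
  defines "F \<equiv> gens (E0 \<union> E1)"
  assumes E0: "\<Union>E0 \<subseteq> {1..n}" and uv: "u \<in> {1..n}" "v \<in> {1..n}" "u \<noteq> v"
    and E1: "\<And>e. e \<in> E1 \<Longrightarrow> \<exists>a b. e = {a, b} \<and> a \<in> {1..n} \<and> b \<in> {1..n} \<and>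
      ({a, u} \<in> E0 \<and> {u, b} \<in> E0 \<or> {a, v} \<in> E0 \<and> {v, b} \<in> E0)"
    and eq: "hser n (idl n (insert (bin u v) F)) = (1 - fps_X\<^sup>2) * hser n (idl n F)"
  shows "hser n (idl n (gens (insert {u, v} E0) :: 'k mpol set))
    = hser n (idl n (gens E0 :: 'k mpol set)) - fps_X\<^sup>2 * hser n (idl n F)"
proof -
  let ?F0 = "gens E0 :: 'k mpol set" and ?f = "bin u v :: 'k mpol"
  have f: "?f \<in> pol_carrier n" using uv by (intro bin_carrier)
  have h0: "hom_gens n ?F0" using E0 by (rule hom_gens_gens)
  have "\<Union>(E0 \<union> E1) \<subseteq> {1..n}" using E0 E1 by fastforce
  then have hF: "hom_gens n F" unfolding F_def by (rule hom_gens_gens)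
  have nz: "nzd n F ?f"
    using eq uv by (intro nzd_hser[OF hF f is_hom_bin] nzd_empty_bin)
  have col: "?f * bin i j \<in> idl n ?F0" if ij: "{i, j} \<in> E1" for i j
  proof -
    \<comment> \<open>\<open>?f\<close> is a combination of the two variables of \<open>u\<close>,
      and also of the two variables of \<open>v\<close>; each of those variables times
      \<open>bin a b\<close> is covered by the determinant identity.\<close>
    have *: "?f * bin a b \<in> idl n ?F0"
      if ab: "a \<in> {1..n}" "b \<in> {1..n}" "w = u \<or> w = v" "{a, w} \<in> E0" "{w, b} \<in> E0" for a b w
    proof -
      have g: "bin a w \<in> idl n ?F0" "bin w b \<in> idl n ?F0"
        using ab(4,5) by (auto intro!: idl_base simp: gens_def)
      have w: "{a, w, b} \<subseteq> {1..n}" using ab uv by auto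
      note t = triangle_in_colon[OF g w]
      from ab(3) show ?thesis
      proof
        assume "w = u"
        then have "yvar v * (xvar w * bin a b) - xvar v * (yvar w * bin a b) = ?f * bin a b"
          by (simp add: bin_def algebra_simps)
        moreover have "yvar v * (xvar w * bin a b) - xvar v * (yvar w * bin a b) \<in> idl n ?F0"
          using uv by (intro idl_diff[OF idl_mult[OF t(1)] idl_mult[OF t(2)]])
            (simp_all add: xvar_carrier yvar_carrier)
        ultimately show ?thesis by simp
      next
        assume "w = v"
        then have "xvar u * (yvar w * bin a b) - yvar u * (xvar w * bin a b) = ?f * bin a b"
          by (simp add: bin_def algebra_simps)
        moreover have "xvar u * (yvar w * bin a b) - yvar u * (xvar w * bin a b) \<in> idl n ?F0"
          using uv by (intro idl_diff[OF idl_mult[OF t(2)] idl_mult[OF t(1)]])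
            (simp_all add: xvar_carrier yvar_carrier)
        ultimately show ?thesis by simp
      qed
    qed
    obtain a b w where w: "{i, j} = {a, b}" "a \<in> {1..n}" "b \<in> {1..n}" "w = u \<or> w = v"
      "{a, w} \<in> E0" "{w, b} \<in> E0" using E1[OF ij] by blast
    then have "?f * bin a b \<in> idl n ?F0" using * by blast
    then have "?f * bin a b \<in> idl n ?F0" "- (?f * bin a b) \<in> idl n ?F0"
      using idl_uminus[of "?f * bin a b" n ?F0] by blast+
    moreover have "bin i j = (bin a b :: 'k mpol) \<or> bin i j = - (bin a b :: 'k mpol)"
      using w(1) bin_swap[of b a] by (auto simp: doubleton_eq_iff)
    ultimately show ?thesis by auto
  qed
  have "g \<in> colon n ?F0 ?f" if g: "g \<in> F" for g
  proof -
    have "g \<in> pol_carrier n" using hF g by (auto simp: hom_gens_def)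
    moreover have "?f * g \<in> idl n ?F0"
    proof (cases "g \<in> ?F0")
      case True
      then show ?thesis using f by (intro idl_mult idl_base)
    next
      case False
      then show ?thesis using g col by (auto simp: F_def gens_def)
    qed
    ultimately show ?thesis by (simp add: colon_def)
  qed
  then have "colon n ?F0 ?f = idl n F"
    using nz f h0 by (intro colon_eqI) (auto simp: F_def gens_Un)
  moreover have "hser n (idl n (insert ?f ?F0)) = hser n (idl n ?F0) - fps_X\<^sup>2 * hser n (colon n ?F0 ?f)"
    using uv by (intro hser_insert[OF h0 f is_hom_bin] nzd_empty_bin)
  moreover have "idl n (gens (insert {u, v} E0)) = idl n (insert ?f ?F0)"
    using idl_gens_insert[of n "{}" u v E0] by simp
  ultimately show ?thesis by simp
qed

section \<open>The Hilbert series of the two types in terms of their legs\<close>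

lemma two_tails:
  assumes "as \<noteq> []" "bs \<noteq> []" "distinct (u # as @ bs)" "set (u # as @ bs) \<subseteq> {1..n}"
    and E: "E = {{u, hd as}, {u, hd bs}, {hd as, hd bs}} \<union> pedges as \<union> pedges bs"
  shows "hser n (idl n (gens E :: 'k::field mpol set))
      = (1 - fps_X\<^sup>2) ^ (length as + length bs - 2) * (1 - fps_X)\<^sup>2 * (1 + 2 * fps_X)
        * hser n (idl n ({} :: 'k mpol set))"
    and "nzd n (gens E :: 'k mpol set) (xvar u)"
proof -
  let ?F = "gens (pedges as) :: 'k mpol set"
  \<comment> \<open>Here \<open>F\<close> is the path \<open>as\<close>, grown first, and the apex
    of the cone is \<open>u\<close> itself, since growth towards \<open>v\<close> continues at
    \<open>u\<close>.\<close>
  define E1 where "E1 = {{hd as, hd bs}, {hd as, u}, {u, hd bs}} \<union> pedges bs"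
  have as: "hd as \<in> set as" using assms(1) by simp
  have vars: "\<Union>(pedges as) \<subseteq> {1..n}" using Union_pedges[of as] assms(4) by auto
  have F: "hom_gens n ?F" using vars by (rule hom_gens_gens)
  have hF: "hser n (idl n ?F) = (1 - fps_X\<^sup>2) ^ (length as - 1) * hser n (idl n ({} :: 'k mpol set))"
    and nz: "nzd n ?F (xvar (hd as))"
    using path_fresh[of n "{} :: 'k mpol set" as] assms by simp_all
  have fr: "vfresh w ?F" if "w \<in> set (u # bs)" for w
    using that assms(3) Union_pedges[of as] by (intro vfresh_gens) auto
  have d: "distinct (hd as # u # bs)" "set (hd as # u # bs) \<subseteq> {1..n}"
    using as assms(3,4) by auto
  have EE: "gens E = ?F \<union> gens E1"
    unfolding gens_Un[symmetric] by (rule arg_cong[where f = gens]) (auto simp: E E1_def insert_commute)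
  have l: "length as + length bs - 2 = (length bs - 1) + (length as - 1)"
    using assms(1,2) by (cases as; cases bs) simp_all
  show "hser n (idl n (gens E :: 'k mpol set))
      = (1 - fps_X\<^sup>2) ^ (length as + length bs - 2) * (1 - fps_X)\<^sup>2 * (1 + 2 * fps_X)
        * hser n (idl n ({} :: 'k mpol set))"
    and "nzd n (gens E :: 'k mpol set) (xvar u)"
    using cone[OF F nz assms(2) d fr E1_def] by (simp_all add: EE hF l power_add algebra_simps)
qed

text \<open>\<open>u\<close> is the vertex of degree 3 and \<open>v\<close> one of its neighbours;
  \<open>cs\<close> is empty when \<open>v\<close> is a leaf.\<close>

lemma hser_first_type:
  assumes ne: "as \<noteq> []" "bs \<noteq> []" and dist: "distinct (u # v # as @ bs @ cs)"
    and S: "set (u # v # as @ bs @ cs) = {1..n}"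
    and E: "E = {{u, v}, {u, hd as}, {u, hd bs}} \<union> pedges as \<union> pedges bs \<union> pedges (v # cs)"
  shows "hser n (idl n (gens E :: 'k::field mpol set)) * (1 - fps_X) ^ (n + 2)
    = (1 + 2 * fps_X - 2 * fps_X ^ 3) * (1 + fps_X) ^ (n - 4)"
proof -
  define T where "T = {{u, hd as}, {u, hd bs}, {hd as, hd bs}} \<union> pedges as \<union> pedges bs"
  define E0 where "E0 = {{u, hd as}, {u, hd bs}} \<union> pedges as \<union> pedges bs \<union> pedges (v # cs)"
  define E1 where "E1 = {{hd as, hd bs}}"
  let ?H = "hser n (idl n ({} :: 'k mpol set))"
  \<comment> \<open>\<open>l\<close> is \<open>n - 4\<close>, introduced so that no truncated
    difference enters the computation with exponents.\<close>
  obtain l where l: "length as + length bs + length cs = l + 2" "length as + length bs - 2 + length cs = l"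
    using ne by (cases as; cases bs) auto
  have n: "n = l + 4" using distinct_card[OF dist, unfolded S] l(1) by simp
  have hd: "hd as \<in> set as" "hd bs \<in> set bs" using ne by simp_all
  have S': "set (u # as @ bs) \<subseteq> {1..n}" "set (v # cs) \<subseteq> {1..n}" "u \<in> {1..n}" "v \<in> {1..n}"
    "hd as \<in> {1..n}" "hd bs \<in> {1..n}"
    using S hd by auto
  have d: "distinct (u # as @ bs)" "distinct (v # cs)" "distinct (u # v # cs)" "u \<noteq> v"
    using dist by auto
  note tt = two_tails[OF ne d(1) S'(1) T_def]
  have VT: "\<Union>T \<subseteq> set (u # as @ bs)"
    using Union_pedges[of as] Union_pedges[of bs] hd by (auto simp: T_def)
  have hT: "hom_gens n (gens T :: 'k mpol set)" using VT S' by (intro hom_gens_gens) blast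
  have fr: "vfresh w (gens T :: 'k mpol set)" if "w \<in> set (v # cs)" for w
    using that VT dist by (intro vfresh_gens) auto
  have C: "gens (E0 \<union> E1) = gens T \<union> gens (pedges (v # cs))"
    unfolding gens_Un[symmetric] by (rule arg_cong[where f = gens]) (auto simp: E0_def E1_def T_def)
  have hC: "hser n (idl n (gens (E0 \<union> E1) :: 'k mpol set))
      = (1 - fps_X\<^sup>2) ^ length cs * hser n (idl n (gens T :: 'k mpol set))"
    unfolding C using path_fresh(1)[OF hT _ d(2) S'(2) fr] by simp
  \<comment> \<open>The edge from \<open>u\<close> to \<open>v\<close> connects two components. To
    see its effect, \<open>v\<close> and \<open>cs\<close> are grown from \<open>u\<close> through
    this edge instead of being placed beside the triangle.\<close>
  have "idl n (gens T \<union> gens (pedges (u # v # cs)) :: 'k mpol set)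
      = idl n (insert (bin u v) (gens (E0 \<union> E1)))"
    unfolding pedges.simps(1) C by (rule idl_gens_insert)
  moreover have "hser n (idl n (gens T \<union> gens (pedges (u # v # cs)) :: 'k mpol set))
      = (1 - fps_X\<^sup>2) ^ length (v # cs) * hser n (idl n (gens T :: 'k mpol set))"
    using S' by (intro path_grow[OF hT tt(2) d(3), THEN conjunct1] fr) auto
  ultimately have eq: "hser n (idl n (insert (bin u v) (gens (E0 \<union> E1)) :: 'k mpol set))
      = (1 - fps_X\<^sup>2) * hser n (idl n (gens (E0 \<union> E1) :: 'k mpol set))"
    by (simp add: hC mult.assoc)
  let ?p = "rev as @ u # bs"
  have E0': "E0 = pedges ?p \<union> pedges (v # cs)"
    unfolding E0_def using ne
    by (simp add: pedges_append pedges_Cons pedges_rev last_rev insert_commute)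
  have Vp: "\<Union>(pedges ?p) \<subseteq> set (u # as @ bs)" using Union_pedges[of ?p] by auto
  have hp: "hom_gens n (gens (pedges ?p) :: 'k mpol set)" using Vp S' by (intro hom_gens_gens) blast
  have frp: "vfresh w (gens (pedges ?p) :: 'k mpol set)" if "w \<in> set (v # cs)" for w
    using that Vp dist by (intro vfresh_gens) auto
  have "hser n (idl n (gens (pedges ?p) :: 'k mpol set)) = (1 - fps_X\<^sup>2) ^ (length as + length bs) * ?H"
    using path_fresh(1)[of n "{} :: 'k mpol set" ?p] d S' by (simp add: add.commute)
  then have h0: "hser n (idl n (gens E0 :: 'k mpol set)) = (1 - fps_X\<^sup>2) ^ (l + 2) * ?H"
    unfolding E0' gens_Un l(1)[symmetric] power_add
    using path_fresh(1)[OF hp _ d(2) S'(2) frp] by (simp add: power_add mult_ac)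
  have E': "E = insert {u, v} E0" by (auto simp: E E0_def)
  have mem: "{hd as, u} \<in> E0" "{u, hd bs} \<in> E0"
    by (auto simp: E0_def insert_commute)
  have "\<exists>a b. e = {a, b} \<and> a \<in> {1..n} \<and> b \<in> {1..n} \<and>
      ({a, u} \<in> E0 \<and> {u, b} \<in> E0 \<or> {a, v} \<in> E0 \<and> {v, b} \<in> E0)" if "e \<in> E1" for e
    using that mem S' unfolding E1_def by blast
  moreover have "\<Union>E0 \<subseteq> {1..n}"
    using Vp S' Union_pedges[of "v # cs"] unfolding E0' by auto
  ultimately have "hser n (idl n (gens E :: 'k mpol set)) = hser n (idl n (gens E0 :: 'k mpol set))
      - fps_X\<^sup>2 * hser n (idl n (gens (E0 \<union> E1) :: 'k mpol set))"
    unfolding E' using S' d(4) eq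
    by (intro hser_bridge)
  \<comment> \<open>With t for \<open>fps_X\<close>, the numerator is
    \<open>(1 + t)^2 - t^2 * (1 + 2 * t)\<close>: the first term comes from the two disjoint paths
    with \<open>l + 2\<close> edges, the second from the colon ideal.\<close>
  also have "\<dots> = (1 - fps_X\<^sup>2) ^ l * (1 - fps_X)\<^sup>2 * (1 + 2 * fps_X - 2 * fps_X ^ 3) * ?H"
    unfolding h0 hC tt(1) l(2)[symmetric] power_add
    by (simp add: power2_eq_square power3_eq_cube algebra_simps)
  finally have hs: "hser n (idl n (gens E :: 'k mpol set))
      = (1 - fps_X\<^sup>2) ^ l * (1 - fps_X)\<^sup>2 * (1 + 2 * fps_X - 2 * fps_X ^ 3) * ?H" .
  have pw: "(1 - fps_X\<^sup>2 :: rat fps) ^ l = (1 + fps_X) ^ l * (1 - fps_X) ^ l"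
    unfolding power_mult_distrib[symmetric]
    by (rule arg_cong[where f = "\<lambda>z. z ^ l"]) (simp add: power2_eq_square algebra_simps)
  have "hser n (idl n (gens E :: 'k mpol set)) * (1 - fps_X) ^ (n + 2)
      = (1 + 2 * fps_X - 2 * fps_X ^ 3) * (1 + fps_X) ^ l
        * ((1 - fps_X) ^ l * (1 - fps_X)\<^sup>2 * (1 - fps_X) ^ (n + 2) * ?H)"
    unfolding hs pw by (simp only: mult_ac)
  \<comment> \<open>The exponents \<open>l\<close>, 2 and \<open>n + 2\<close> add up to
    \<open>2 * n\<close> because \<open>n = l + 4\<close>.\<close>
  also have "(1 - fps_X) ^ l * (1 - fps_X)\<^sup>2 * (1 - fps_X) ^ (n + 2) = (1 - fps_X :: rat fps) ^ (2 * n)"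
    unfolding power_add[symmetric] by (rule arg_cong[where f = "power _"]) (simp add: n)
  finally show ?thesis using hser_0[where ?'k = 'k, of n] by (simp add: n)
qed

text \<open>As for the first type, except that the colon ideal acquires a triangle at each end of
  the removed edge, and with it the factor of a triangle twice.\<close>

lemma hser_second_type:
  assumes ne: "as \<noteq> []" "bs \<noteq> []" "cs \<noteq> []" "ds \<noteq> []"
    and dist: "distinct (u # v # as @ bs @ cs @ ds)"
    and S: "set (u # v # as @ bs @ cs @ ds) = {1..n}"
    and E: "E = {{u, v}, {u, hd as}, {u, hd bs}, {v, hd cs}, {v, hd ds}}
      \<union> pedges as \<union> pedges bs \<union> pedges cs \<union> pedges ds"
  shows "hser n (idl n (gens E :: 'k::field mpol set)) * (1 - fps_X) ^ (n + 2)
    = (1 + 4 * fps_X + 5 * fps_X ^ 2 - 3 * fps_X ^ 4) * (1 + fps_X) ^ (n - 6)"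
proof -
  define T where "T = {{u, hd as}, {u, hd bs}, {hd as, hd bs}} \<union> pedges as \<union> pedges bs"
  define T' where "T' = {{v, hd cs}, {v, hd ds}, {hd cs, hd ds}} \<union> pedges cs \<union> pedges ds"
  define E0 where "E0 = {{u, hd as}, {u, hd bs}, {v, hd cs}, {v, hd ds}}
    \<union> pedges as \<union> pedges bs \<union> pedges cs \<union> pedges ds"
  define E1 where "E1 = {{hd as, hd bs}, {hd cs, hd ds}}"
  let ?H = "hser n (idl n ({} :: 'k mpol set))"
  obtain l where l: "length as + length bs + (length cs + length ds) = l + 4"
      "(length as + length bs - 2) + (length cs + length ds - 2) = l"
    using ne by (cases as; cases bs; cases cs; cases ds) auto
  have n: "n = l + 6" using distinct_card[OF dist, unfolded S] l(1) by simp
  have hd: "hd as \<in> set as" "hd bs \<in> set bs" "hd cs \<in> set cs" "hd ds \<in> set ds"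
    using ne by simp_all
  have S': "set (u # as @ bs) \<subseteq> {1..n}" "set (v # cs @ ds) \<subseteq> {1..n}" "u \<in> {1..n}" "v \<in> {1..n}"
    "hd as \<in> {1..n}" "hd bs \<in> {1..n}" "hd cs \<in> {1..n}" "hd ds \<in> {1..n}"
    using S hd by auto
  have d: "distinct (u # as @ bs)" "distinct (v # cs @ ds)" "u \<noteq> v"
    using dist by auto
  note tt = two_tails[OF ne(1,2) d(1) S'(1) T_def]
  have VT: "\<Union>T \<subseteq> set (u # as @ bs)"
    using Union_pedges[of as] Union_pedges[of bs] hd by (auto simp: T_def)
  have hT: "hom_gens n (gens T :: 'k mpol set)" using VT S' by (intro hom_gens_gens) blast
  have fr: "vfresh w (gens T :: 'k mpol set)" if "w \<in> set (v # cs @ ds)" for w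
    using that VT dist by (intro vfresh_gens) auto
  have frv: "vfresh v (gens T :: 'k mpol set)" using fr by simp
  let ?T = "insert (bin u v) (gens T) :: 'k mpol set"
  note lf = leaf_nzd[OF hT frv d(3) S'(3,4) tt(2)]
  have hT': "hom_gens n ?T"
    using hT S' is_hom_bin by (auto simp: hom_gens_insert intro!: bin_carrier)
  have C: "gens (E0 \<union> E1) = gens T \<union> gens T'"
    unfolding gens_Un[symmetric]
    by (rule arg_cong[where f = gens]) (auto simp: E0_def E1_def T_def T'_def)
  have g1: "hser n (idl n (gens T \<union> gens T' :: 'k mpol set))
      = (1 - fps_X\<^sup>2) ^ (length cs + length ds - 2) * (1 - fps_X)\<^sup>2 * (1 + 2 * fps_X)
        * hser n (idl n (gens T :: 'k mpol set))"
    by (rule triangle_grow[OF hT nzd_xvar_vfresh[OF frv] ne(3,4) d(2) S'(2) fr T'_def]) simp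
  \<comment> \<open>The second triangle is attached with and without the edge from \<open>u\<close>
    to \<open>v\<close>. Its starting variable \<open>xvar v\<close> is a nonzerodivisor in both
    cases: in \<open>g1\<close> because it is new, here because \<open>v\<close> has become a leaf
    at \<open>u\<close>.\<close>
  have g2: "hser n (idl n (?T \<union> gens T'))
      = (1 - fps_X\<^sup>2) ^ (length cs + length ds - 2) * (1 - fps_X)\<^sup>2 * (1 + 2 * fps_X)
        * hser n (idl n ?T)"
    by (rule triangle_grow[OF hT' lf(2) ne(3,4) d(2) S'(2) vfresh_insert_bin[OF _ _ fr] T'_def])
       (use dist in auto)
  have eq: "hser n (idl n (insert (bin u v) (gens (E0 \<union> E1)) :: 'k mpol set))
      = (1 - fps_X\<^sup>2) * hser n (idl n (gens (E0 \<union> E1) :: 'k mpol set))"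
    using g1 g2 hser_insert_bin[OF hT d(3) S'(3,4) lf(1)] by (simp add: C mult_ac)
  let ?p = "rev as @ u # bs" and ?q = "rev cs @ v # ds"
  have E0': "E0 = pedges ?p \<union> pedges ?q"
    unfolding E0_def using ne
    by (simp add: pedges_append pedges_Cons pedges_rev last_rev insert_commute) blast
  have Vp: "\<Union>(pedges ?p) \<subseteq> set (u # as @ bs)" using Union_pedges[of ?p] by auto
  have hp: "hom_gens n (gens (pedges ?p) :: 'k mpol set)" using Vp S' by (intro hom_gens_gens) blast
  have frp: "vfresh w (gens (pedges ?p) :: 'k mpol set)" if "w \<in> set ?q" for w
    using that Vp dist by (intro vfresh_gens) auto
  have "hser n (idl n (gens (pedges ?p) :: 'k mpol set)) = (1 - fps_X\<^sup>2) ^ (length as + length bs) * ?H"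
    using path_fresh(1)[of n "{} :: 'k mpol set" ?p] d S' by (simp add: add.commute)
  moreover have "hser n (idl n (gens (pedges ?p) \<union> gens (pedges ?q) :: 'k mpol set))
      = (1 - fps_X\<^sup>2) ^ (length cs + length ds) * hser n (idl n (gens (pedges ?p) :: 'k mpol set))"
    using path_fresh(1)[OF hp _ _ _ frp, of ?q] d S' by (simp add: add.commute)
  ultimately have h0: "hser n (idl n (gens E0 :: 'k mpol set)) = (1 - fps_X\<^sup>2) ^ (l + 4) * ?H"
    unfolding E0' gens_Un by (simp add: l(1)[symmetric] power_add mult_ac)
  have E': "E = insert {u, v} E0" by (auto simp: E E0_def)
  have mem: "{hd as, u} \<in> E0" "{u, hd bs} \<in> E0" "{hd cs, v} \<in> E0" "{v, hd ds} \<in> E0"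
    by (auto simp: E0_def insert_commute)
  have "\<exists>a b. e = {a, b} \<and> a \<in> {1..n} \<and> b \<in> {1..n} \<and>
      ({a, u} \<in> E0 \<and> {u, b} \<in> E0 \<or> {a, v} \<in> E0 \<and> {v, b} \<in> E0)" if "e \<in> E1" for e
    using that mem S' unfolding E1_def by blast
  moreover have "\<Union>E0 \<subseteq> {1..n}"
    using Vp S' Union_pedges[of ?q] unfolding E0' by auto
  ultimately have "hser n (idl n (gens E :: 'k mpol set)) = hser n (idl n (gens E0 :: 'k mpol set))
      - fps_X\<^sup>2 * hser n (idl n (gens (E0 \<union> E1) :: 'k mpol set))"
    unfolding E' using S' d(3) eq
    by (intro hser_bridge)
  also have "\<dots> = (1 - fps_X\<^sup>2) ^ (l + 4) * ?H
      - fps_X\<^sup>2 * ((1 - fps_X\<^sup>2) ^ l * ((1 - fps_X)\<^sup>2)\<^sup>2 * (1 + 2 * fps_X)\<^sup>2 * ?H)"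
    unfolding h0 C g1 tt(1) l(2)[symmetric] power_add by (simp add: power2_eq_square mult_ac)
  also have "\<dots> = (1 - fps_X\<^sup>2) ^ l * ((1 - fps_X)\<^sup>2)\<^sup>2
      * (1 + 4 * fps_X + 5 * fps_X ^ 2 - 3 * fps_X ^ 4) * ?H"
  proof -
    \<comment> \<open>After division by \<open>(1 - z)^4\<close> this reads
      \<open>(1 + z)^4 - z^2 * (1 + 2 * z)^2\<close>, which is the numerator.\<close>
    have "(1 - z\<^sup>2) ^ 4 - z\<^sup>2 * (((1 - z)\<^sup>2)\<^sup>2 * (1 + 2 * z)\<^sup>2)
        = ((1 - z)\<^sup>2)\<^sup>2 * (1 + 4 * z + 5 * z ^ 2 - 3 * z ^ 4)" for z :: "rat fps"
      by (simp add: power2_eq_square power4_eq_xxxx algebra_simps)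
    then have "(1 - fps_X\<^sup>2) ^ l * ((1 - fps_X\<^sup>2) ^ 4
          - fps_X\<^sup>2 * (((1 - fps_X)\<^sup>2)\<^sup>2 * (1 + 2 * fps_X)\<^sup>2)) * ?H
        = (1 - fps_X\<^sup>2) ^ l * (((1 - fps_X)\<^sup>2)\<^sup>2
          * (1 + 4 * fps_X + 5 * fps_X ^ 2 - 3 * fps_X ^ 4)) * ?H" by simp
    then show ?thesis by (simp only: power_add right_diff_distrib left_diff_distrib mult_ac)
  qed
  finally have hs: "hser n (idl n (gens E :: 'k mpol set)) = (1 - fps_X\<^sup>2) ^ l * ((1 - fps_X)\<^sup>2)\<^sup>2
      * (1 + 4 * fps_X + 5 * fps_X ^ 2 - 3 * fps_X ^ 4) * ?H" .
  have pw: "(1 - fps_X\<^sup>2 :: rat fps) ^ l = (1 + fps_X) ^ l * (1 - fps_X) ^ l"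
    unfolding power_mult_distrib[symmetric]
    by (rule arg_cong[where f = "\<lambda>z. z ^ l"]) (simp add: power2_eq_square algebra_simps)
  have "hser n (idl n (gens E :: 'k mpol set)) * (1 - fps_X) ^ (n + 2)
      = (1 + 4 * fps_X + 5 * fps_X ^ 2 - 3 * fps_X ^ 4) * (1 + fps_X) ^ l
        * ((1 - fps_X) ^ l * ((1 - fps_X)\<^sup>2)\<^sup>2 * (1 - fps_X) ^ (n + 2) * ?H)"
    unfolding hs pw by (simp only: mult_ac)
  \<comment> \<open>The exponents \<open>l\<close>, 4 and \<open>n + 2\<close> add up to
    \<open>2 * n\<close> because \<open>n = l + 6\<close>.\<close>
  also have "(1 - fps_X) ^ l * ((1 - fps_X)\<^sup>2)\<^sup>2 * (1 - fps_X) ^ (n + 2) = (1 - fps_X :: rat fps) ^ (2 * n)"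
    unfolding power_add[symmetric] power_mult[symmetric]
    by (rule arg_cong[where f = "power _"]) (simp add: n)
  finally show ?thesis using hser_0[where ?'k = 'k, of n] by (simp add: n)
qed

section \<open>The quotient ring\<close>

text \<open>Passes from vector spaces over a type to dimension over a subfield inside a ring: each
  further basis vector is one line extension.\<close>

lemma dimension_span:
  fixes B :: "'k::field mpol set"
  assumes "finite B" "mp.independent B" "B \<subseteq> pol_carrier n"
  shows "ring.dimension (pol_ring n) (card B) (range const_pol) (mp.span B)"
proof -
  interpret cring "pol_ring n :: 'k mpol ring" by (rule pol_ring_cring)
  show ?thesis using assms
  proof (induct B rule: finite_induct)
    case empty
    have "dimension 0 (range const_pol) {\<zero>\<^bsub>pol_ring n\<^esub>}" by (rule zero_dim)
    then show ?case by (simp add: pol_ring_def)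
  next
    case (insert b B)
    have b: "b \<in> carrier (pol_ring n)" "b \<notin> mp.span B"
      and IH: "dimension (card B) (range const_pol) (mp.span B)"
      using insert by (auto simp: mp.independent_insert pol_ring_def)
    have "mp.span (insert b B) = line_extension (range const_pol) b (mp.span B)"
    proof (intro Set.set_eqI)
      fix x
      have "x \<in> mp.span (insert b B) \<longleftrightarrow> (\<exists>k. \<exists>y\<in>mp.span B. x = scal k b + y)"
        unfolding mp.span_breakdown_eq
        by (metis add_diff_cancel_left' add.commute diff_add_cancel)
      then show "x \<in> mp.span (insert b B) \<longleftrightarrow> x \<in> line_extension (range const_pol) b (mp.span B)"
        unfolding line_extension_mem_iff by (auto simp: pol_ring_def)
    qed
    with Suc_dim[OF b IH] insert.hyps show ?case by simp
  qed
qed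

lemma subfield_const: "subfield (range const_pol) (pol_ring n :: 'k::field mpol ring)"
proof -
  interpret cring "pol_ring n :: 'k mpol ring" by (rule pol_ring_cring)
  have sub: "subcring (range const_pol) (pol_ring n :: 'k mpol ring)"
  proof (intro subcringI subringI)
    fix h :: "'k mpol" assume "h \<in> range const_pol"
    then obtain c where c: "h = const_pol c" by blast
    have "\<ominus>\<^bsub>pol_ring n\<^esub> h = const_pol (- c)"
      by (rule minus_equality)
         (auto simp: c pol_ring_def pol_carrier_const const_pol_simps(3)[symmetric] const_pol_simps(1))
    then show "\<ominus>\<^bsub>pol_ring n\<^esub> h \<in> range const_pol" by simp
  qed (auto simp: pol_ring_def pol_carrier_const const_pol_simps(3,4)[symmetric] mult.commute
      const_pol_simps(2)[symmetric])
  show ?thesis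
  proof (rule subfieldI[OF sub])
    have "k \<in> Units (pol_ring n \<lparr>carrier := range const_pol\<rparr>)"
      if "k = const_pol c" "c \<noteq> 0" for k :: "'k mpol" and c
    proof -
      have "const_pol (inverse c) * k = 1"
        using that by (simp add: const_pol_simps(4)[symmetric] const_pol_simps(2))
      then show ?thesis
        using that by (auto simp: Units_def pol_ring_def mult.commute)
    qed
    moreover have "k \<noteq> 0" if "k \<in> Units (pol_ring n \<lparr>carrier := range const_pol\<rparr>)" for k :: "'k mpol"
      using that by (auto simp: Units_def pol_ring_def)
    moreover have "const_pol c \<noteq> 0 \<longleftrightarrow> c \<noteq> (0 :: 'k)" for c
      by (metis const_pol_def lookup_single_eq lookup_zero single_zero)
    ultimately show "Units (pol_ring n \<lparr>carrier := range const_pol\<rparr>)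
        = range const_pol - {\<zero>\<^bsub>pol_ring n\<^esub> :: 'k mpol}"
      by (auto simp: pol_ring_def Units_def)
  qed
qed

lemma genideal_eq_idl:
  fixes F :: "'k::field mpol set"
  assumes "F \<subseteq> pol_carrier n"
  shows "genideal (pol_ring n) F = idl n F"
proof
  interpret cring "pol_ring n :: 'k mpol ring" by (rule pol_ring_cring)
  have F: "F \<subseteq> carrier (pol_ring n)" using assms by (simp add: pol_ring_def)
  show "idl n F \<subseteq> genideal (pol_ring n) F"
  proof
    interpret I: ideal "genideal (pol_ring n) F" "pol_ring n" using F by (rule genideal_ideal)
    fix p assume "p \<in> idl n F"
    then show "p \<in> genideal (pol_ring n) F"
    proof induct
      case zero
      show ?case using I.zero_closed by (simp add: pol_ring_def)
    next
      case (step f q p)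
      have "q \<otimes>\<^bsub>pol_ring n\<^esub> f \<oplus>\<^bsub>pol_ring n\<^esub> p \<in> genideal (pol_ring n) F"
        using step genideal_self[OF F] by (intro I.a_closed I.I_l_closed) (auto simp: pol_ring_def)
      then show ?case by (simp add: pol_ring_def)
    qed
  qed
  have "ideal (idl n F) (pol_ring n)"
  proof (rule idealI)
    show "ring (pol_ring n :: 'k mpol ring)" by (rule ring_axioms)
    show "subgroup (idl n F) (add_monoid (pol_ring n))"
    proof (rule add.subgroupI)
      show "idl n F \<subseteq> carrier (pol_ring n)" using idl_carrier[OF assms] by (simp add: pol_ring_def)
      show "idl n F \<noteq> {}" using idl.zero by blast
      fix p q assume p: "p \<in> idl n F" and q: "q \<in> idl n F"
      show "p \<oplus>\<^bsub>pol_ring n\<^esub> q \<in> idl n F" using idl_add[OF p q] by (simp add: pol_ring_def)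
      have "\<ominus>\<^bsub>pol_ring n\<^esub> p = - p"
        using p idl_carrier[OF assms]
        by (intro minus_equality) (auto simp: pol_ring_def pol_carrier_uminus)
      then show "\<ominus>\<^bsub>pol_ring n\<^esub> p \<in> idl n F" using idl_uminus[OF p] by simp
    qed
  qed (auto simp: pol_ring_def idl_mult idl_mult_right)
  then show "genideal (pol_ring n) F \<subseteq> idl n F"
    by (rule genideal_minimal) (auto intro: idl_base)
qed

text \<open>Homogeneity of positive degree makes the ideal proper, so that the constants embed into the
  quotient.\<close>

lemma quot_hilbert_series_idl:
  fixes F :: "'k::field mpol set"
  assumes F: "hom_gens n F" and pos: "\<And>f. f \<in> F \<Longrightarrow> \<exists>d>0. is_hom d f"
  shows "quot_hilbert_series n (idl n F) = hser n (idl n F)"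
proof -
  interpret cring "pol_ring n :: 'k mpol ring" by (rule pol_ring_cring)
  have FS: "F \<subseteq> pol_carrier n" using F by (auto simp: hom_gens_def)
  let ?J = "idl n F" and ?K = "range const_pol :: 'k mpol set"
  have id: "ideal ?J (pol_ring n)"
    using genideal_ideal[of F] FS genideal_eq_idl[OF FS] by (simp add: pol_ring_def)
  interpret I: ideal ?J "pol_ring n" by (rule id)
  interpret hom: ring_hom_ring "pol_ring n" "pol_ring n Quot ?J" "quot_map n ?J"
    unfolding quot_map_def[abs_def] by (rule I.rcos_ring_hom_ring)
  have one: "\<one>\<^bsub>pol_ring n\<^esub> = (1 :: 'k mpol)" by (simp add: pol_ring_def)
  have zero: "\<zero>\<^bsub>pol_ring n Quot ?J\<^esub> = ?J" by (simp add: FactRing_def)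
  have ker: "quot_map n ?J p = ?J \<longleftrightarrow> p \<in> ?J" if "p \<in> pol_carrier n" for p
  proof
    assume "quot_map n ?J p = ?J"
    then show "p \<in> ?J"
      using I.a_rcos_self that by (auto simp: quot_map_def pol_ring_def)
  next
    assume "p \<in> ?J" then show "quot_map n ?J p = ?J"
      using I.a_rcos_const by (simp add: quot_map_def)
  qed
  have "p = 0" if p: "p \<in> ?J" "is_hom 0 p" for p
  proof -
    have "hcomp 0 p = 0" using p(1)
    proof induct
      case (step f q p)
      then obtain d where "d > 0" "is_hom d f" using pos by blast
      with step show ?case using hcomp_mult[of d f 0 q] by (simp add: hcomp_add)
    qed simp
    with p(2) show ?thesis by (simp add: hcomp_is_hom)
  qed
  from this[of 1] have "1 \<notin> ?J" using is_hom_const[of 1] by (auto simp: const_pol_simps)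
  then have ne: "\<one>\<^bsub>pol_ring n Quot ?J\<^esub> \<noteq> \<zero>\<^bsub>pol_ring n Quot ?J\<^esub>"
    using ker[of 1] hom.hom_one unfolding zero one by (simp add: pol_carrier_simps)
  have K': "subfield (quot_map n ?J ` ?K) (pol_ring n Quot ?J)"
    using hom.img_is_subfield(2)[OF subfield_const ne] .
  have "ring.dim (pol_ring n Quot ?J) (quot_map n ?J ` ?K) (quot_map n ?J ` homogeneous_part n d)
      = hdim n (UNIV :: 'k mpol set) d - hdim n ?J d" for d
  proof -
    have dimI: "ring.dimension (pol_ring n) (hdim n J d) ?K (J \<inter> homogeneous_part n d)"
      if J: "mp.subspace J" for J
    proof -
      obtain B where B: "B \<subseteq> J \<inter> homogeneous_part n d" "finite B" "mp.independent B"
        "J \<inter> homogeneous_part n d \<subseteq> mp.span B" "card B = hdim n J d"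
        using hdim_basis by blast
      have "mp.span B = J \<inter> homogeneous_part n d"
        using B(1,4) J subspace_hom
        by (intro equalityI mp.span_minimal mp.subspace_inter)
      moreover have "B \<subseteq> pol_carrier n" using B(1) by (auto simp: homogeneous_part_iff)
      ultimately show ?thesis using dimension_span[OF B(2,3)] B(5) by metis
    qed
    \<comment> \<open>Rank and nullity of the quotient map restricted to the forms of degree
      \<open>d\<close>; its kernel there is the degree part of the ideal.\<close>
    have "a_kernel (pol_ring n \<lparr>carrier := homogeneous_part n d\<rparr>) (pol_ring n Quot ?J) (quot_map n ?J)
        = ?J \<inter> homogeneous_part n d"
    proof -
      have "p \<in> homogeneous_part n d \<and> quot_map n ?J p = ?J \<longleftrightarrow> p \<in> ?J \<and> p \<in> homogeneous_part n d"
        for p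
        using ker[of p] by (auto simp: homogeneous_part_iff)
      then show ?thesis unfolding a_kernel_def' zero by (simp add: set_eq_iff)
    qed
    then have "ring.dimension (pol_ring n Quot ?J) (hdim n (UNIV :: 'k mpol set) d - hdim n ?J d)
        (quot_map n ?J ` ?K) (quot_map n ?J ` homogeneous_part n d)"
      using hom.rank_nullity_theorem[OF subfield_const ne] dimI[OF mp.subspace_UNIV]
        dimI[OF subspace_idl] by simp
    then show ?thesis
      using hom.S.dimI[OF K'] by (simp add: over_def)
  qed
  moreover have "hdim n ?J d \<le> hdim n (UNIV :: 'k mpol set) d" for d
    by (rule hdim_mono[OF subset_UNIV subspace_idl])
  ultimately show ?thesis
    by (intro fps_ext) (simp add: quot_hilbert_series_def hser_def of_nat_diff)
qed

lemma quot_hilbert_series_binomial: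
  assumes "\<And>e. e \<in> E \<Longrightarrow> \<exists>u\<in>{1..n}. \<exists>v\<in>{1..n}. u \<noteq> v \<and> e = {u, v}"
  shows "quot_hilbert_series n (binomial_edge_ideal n E :: 'k mpol set)
    = hser n (idl n (gens E :: 'k::field mpol set))"
proof -
  let ?F = "{xvar i * yvar j - xvar j * yvar i |i j. 1 \<le> i \<and> i < j \<and> j \<le> n \<and> {i, j} \<in> E} :: 'k mpol set"
  have F: "?F = {bin i j |i j. 1 \<le> i \<and> i < j \<and> j \<le> n \<and> {i, j} \<in> E}" by (simp add: bin_def)
  have "?F \<subseteq> pol_carrier n" unfolding F by (auto intro!: bin_carrier)
  then have "binomial_edge_ideal n E = idl n ?F"
    unfolding binomial_edge_ideal_def by (rule genideal_eq_idl)
  also have "\<dots> = idl n (gens E)"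
  proof (rule idl_eqI)
    show "?F \<subseteq> idl n (gens E)" unfolding F gens_def by (auto intro!: idl_base)
    show "gens E \<subseteq> idl n ?F"
    proof
      fix f :: "'k mpol" assume "f \<in> gens E"
      then obtain i j where ij: "f = bin i j" "{i, j} \<in> E" by (auto simp: gens_def)
      with assms[of "{i, j}"] have "i \<in> {1..n}" "j \<in> {1..n}" "i \<noteq> j"
        by (auto simp: doubleton_eq_iff)
      \<comment> \<open>The defining generators follow the order of the vertices; the opposite
        orientation is recovered by a sign.\<close>
      then have "i < j \<and> bin i j \<in> ?F \<or> j < i \<and> bin j i \<in> ?F"
        using ij(2) unfolding F
        by (cases i j rule: linorder_cases; simp) (use insert_commute in \<open>metis\<close>)+
      then show "f \<in> idl n ?F"
        using idl_base[of _ ?F n] idl_uminus[of "bin j i" n ?F] by (auto simp: ij bin_swap[of i j])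
    qed
  qed
  finally have eq: "binomial_edge_ideal n E = idl n (gens E :: 'k mpol set)" .
  have "\<Union>E \<subseteq> {1..n}" using assms by fastforce
  then have "hom_gens n (gens E :: 'k mpol set)" by (rule hom_gens_gens)
  moreover have "\<exists>d>0. is_hom d f" if "f \<in> gens E" for f :: "'k mpol"
    using that is_hom_bin by (intro exI[of _ 2]) (auto simp: gens_def)
  ultimately show ?thesis
    unfolding eq by (rule quot_hilbert_series_idl)
qed

section \<open>Legs of a tree\<close>

lemma pedges_nth: "Suc i < length xs \<Longrightarrow> {xs ! i, xs ! Suc i} \<in> pedges xs"
proof (induct xs arbitrary: i rule: pedges.induct)
  case (1 a b l)
  then show ?case by (cases i) auto
qed auto

lemma pedges_cycle:
  assumes "distinct c" "length c \<ge> 3" "pedges c \<subseteq> E" "{last c, hd c} \<in> E"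
  shows "graph_cycle E c"
  unfolding graph_cycle_def
proof (intro conjI allI impI)
  fix i assume i: "i < length c"
  show "{c ! i, c ! (Suc i mod length c)} \<in> E"
  proof (cases "Suc i = length c")
    case True
    have "c \<noteq> []" using assms(2) by auto
    then have "c ! i = last c" "c ! 0 = hd c"
      using True[symmetric] by (simp_all add: last_conv_nth hd_conv_nth)
    with True assms(4) show ?thesis by simp
  next
    case False
    with i pedges_nth[of i c] assms(3) show ?thesis by auto
  qed
qed (use assms in auto)

lemma pedges_hd_neighbour:
  assumes "distinct (c # xs)" "{c, x} \<in> pedges (c # xs)"
  shows "xs \<noteq> [] \<and> x = hd xs"
proof (cases xs)
  case (Cons y ys)
  with assms(1) Union_pedges[of xs] have "{c, x} \<notin> pedges xs" by auto
  with assms Cons show ?thesis by (auto simp: doubleton_eq_iff)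
qed (use assms in simp)

text \<open>A branch at \<open>c\<close> pointing away from \<open>p\<close>. The last condition
  makes it the whole branch: no edge of the graph leaves \<open>xs\<close> except along the path
  from \<open>c\<close>.\<close>

definition leg :: "'a set set \<Rightarrow> 'a \<Rightarrow> 'a \<Rightarrow> 'a list \<Rightarrow> bool" where
  "leg E p c xs \<longleftrightarrow> xs \<noteq> [] \<and> distinct (p # c # xs) \<and> pedges (c # xs) \<subseteq> E \<and>
    (\<forall>e\<in>E. e \<inter> set xs \<noteq> {} \<longrightarrow> e \<in> pedges (c # xs))"

text \<open>Take a longest path that begins with \<open>p\<close>, \<open>c\<close>,
  \<open>a\<close>. An inner vertex of the leg has degree at most 2, so its path neighbours are all
  its neighbours. At the end vertex a further edge would either prolong the path or close a cycle.
  Including \<open>p\<close> and \<open>c\<close> in the path covers edges that return to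
  them.\<close>

lemma leg_exists:
  assumes G: "simple_graph V E" and acyc: "\<nexists>c. graph_cycle E c"
    and pc: "{p, c} \<in> E" "{c, a} \<in> E" "a \<noteq> p"
    and deg: "\<And>w. w \<in> V \<Longrightarrow> w \<notin> {p, c} \<Longrightarrow> vertex_degree E w \<le> 2"
  obtains xs where "leg E p c xs" "hd xs = a"
proof -
  have finV: "finite V" and EV: "\<And>e. e \<in> E \<Longrightarrow> \<exists>x\<in>V. \<exists>y\<in>V. x \<noteq> y \<and> e = {x, y}"
    using G by (auto simp: simple_graph_def)
  have "E \<subseteq> Pow V" using EV by blast
  then have finE: "finite E" using finV finite_subset by blast
  have neq: "x \<noteq> y" "x \<in> V" "y \<in> V" if "{x, y} \<in> E" for x y
    using EV[OF that] by (auto simp: doubleton_eq_iff)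
  define P where "P = (\<lambda>xs. xs \<noteq> [] \<and> hd xs = a \<and> distinct (p # c # xs) \<and> pedges (p # c # xs) \<subseteq> E)"
  have setV: "set xs \<subseteq> V" if "P xs" for xs
  proof -
    have "x \<in> V" if "x \<in> set xs" for x
    proof -
      from that obtain ys zs where xs: "xs = ys @ x # zs" by (auto dest: split_list)
      have "{last (c # ys), x} \<in> pedges ((c # ys) @ x # zs)"
        by (subst pedges_append) auto
      then have "{last (c # ys), x} \<in> E"
        using \<open>P xs\<close> unfolding P_def xs by auto
      then show ?thesis by (rule neq)
    qed
    then show ?thesis by blast
  qed
  have bnd: "length xs \<le> card V" if "P xs" for xs
  proof -
    have "distinct xs" using that by (simp add: P_def)
    then show ?thesis using card_mono[OF finV setV[OF that]] by (simp add: distinct_card)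
  qed
  have "P [a]" using pc neq[OF pc(1)] neq[OF pc(2)] by (auto simp: P_def)
  then obtain xs where P: "P xs" and max: "\<And>ys. P ys \<Longrightarrow> length ys \<le> length xs"
    using ex_has_greatest_nat[of P "[a]" length "Suc (card V)"] bnd by (auto simp: less_Suc_eq_le)
  have xs: "xs \<noteq> []" "hd xs = a" "distinct (p # c # xs)" "pedges (p # c # xs) \<subseteq> E"
    using P by (auto simp: P_def)
  have sub: "pedges (c # xs) \<subseteq> E" using xs(4) by simp
  have "e \<in> pedges (c # xs)" if e: "e \<in> E" "x \<in> e" and x: "x \<in> set xs" for e x
  proof -
    obtain ys zs where yz: "xs = ys @ x # zs" using x by (auto dest: split_list)
    define q where "q = last (c # ys)"
    have q: "{q, x} \<in> pedges (c # xs)"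
      using pedges_append[of "c # ys" "x # zs"] by (simp add: yz q_def)
    show ?thesis
    proof (cases zs)
      case (Cons z zs')
      have z: "{x, z} \<in> pedges (c # xs)"
        using pedges_append[of "c # ys" "x # zs"] by (simp add: yz Cons)
      have "q \<in> set (c # ys)" unfolding q_def by (rule last_in_set) simp
      then have "q \<noteq> z" using xs(3) by (auto simp: yz Cons)
      moreover have "q \<noteq> x" "x \<noteq> z" using neq q z sub by blast+
      ultimately have ne: "{q, x} \<noteq> {x, z}" by (auto simp: doubleton_eq_iff)
      have "vertex_degree E x \<le> 2" using deg[of x] setV[OF P] x xs(3) by auto
      then have "card {e \<in> E. x \<in> e} \<le> card {{q, x}, {x, z}}" using ne by (simp add: vertex_degree_def)
      moreover have "{{q, x}, {x, z}} \<subseteq> {e \<in> E. x \<in> e}" using q z sub by auto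
      ultimately have eq: "{{q, x}, {x, z}} = {e \<in> E. x \<in> e}"
        using finE by (intro card_seteq) auto
      have "e \<in> {{q, x}, {x, z}}" unfolding eq using e by simp
      then show ?thesis using q z by auto
    next
      case Nil
      \<comment> \<open>\<open>x\<close> is the end of the path. Either \<open>z\<close> is off the
        path, against maximality, or it is the predecessor of \<open>x\<close>, or the path from
        \<open>z\<close> to \<open>x\<close> closes up to a cycle.\<close>
      obtain z where z: "e = {x, z}" "x \<noteq> z" using EV[OF e(1)] e(2) by auto
      let ?L = "p # c # xs"
      have L: "?L = (p # c # ys) @ [x]" by (simp add: yz Nil)
      show ?thesis
      proof (cases "z \<in> set ?L")
        case False
        have "last ?L = x" by (simp add: yz Nil)
        then have "pedges (p # c # xs @ [z]) = insert {x, z} (pedges ?L)"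
          using pedges_append[of ?L "[z]"] by (simp del: pedges.simps(1))
        then have "pedges (p # c # xs @ [z]) \<subseteq> E"
          using xs(4) e(1) z(1) by (simp del: pedges.simps)
        then have "P (xs @ [z])"
          using xs(1-3) False unfolding P_def by (auto simp del: pedges.simps)
        with max[of "xs @ [z]"] show ?thesis by simp
      next
        case True
        then have "z \<in> set (p # c # ys)" using z(2) by (auto simp: L)
        then obtain as bs where ab: "p # c # ys = as @ z # bs" by (meson split_list)
        show ?thesis
        proof (cases "bs = []")
          case True
          then have "q = z" using arg_cong[OF ab, of last] by (simp add: q_def)
          with q z show ?thesis by (simp add: insert_commute)
        next
          case False
          have L': "?L = as @ (z # bs @ [x])" using L ab by simp
          have "distinct (z # bs @ [x])" using xs(3) unfolding L' by simp
          moreover have "pedges (z # bs @ [x]) \<subseteq> E"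
            using xs(4) pedges_append[of as "z # bs @ [x]"] unfolding L' by (cases "as = []") auto
          moreover have "length (z # bs @ [x]) \<ge> 3" using False by (cases bs) auto
          moreover have "{last (z # bs @ [x]), hd (z # bs @ [x])} \<in> E" using e(1) z by simp
          ultimately have "graph_cycle E (z # bs @ [x])" by (intro pedges_cycle)
          with acyc show ?thesis by blast
        qed
      qed
    qed
  qed
  then have "leg E p c xs" using xs sub by (auto simp: leg_def)
  with xs(2) show thesis by (intro that)
qed

text \<open>At the first vertex of \<open>xs\<close> on \<open>ys\<close>, the edge arriving along
  \<open>xs\<close> touches \<open>ys\<close> and hence belongs to the path from \<open>c'\<close>.
  Its other end is not on \<open>ys\<close>, so it is \<open>c'\<close>; as \<open>c'\<close> is not
  on \<open>xs\<close>, the legs leave from the same vertex and have the same head.\<close>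

lemma leg_disjoint:
  assumes l: "leg E p c xs" "leg E p' c' ys" and pc: "{p, c} = {p', c'}"
    and ne: "c \<noteq> c' \<or> hd xs \<noteq> hd ys"
  shows "set xs \<inter> set ys = {}"
proof (rule ccontr)
  assume "set xs \<inter> set ys \<noteq> {}"
  then have "\<exists>x\<in>set xs. x \<in> set ys" by blast
  then obtain as x bs where x: "xs = as @ x # bs" "x \<in> set ys" "\<And>y. y \<in> set as \<Longrightarrow> y \<notin> set ys"
    using split_list_first_prop[of xs "\<lambda>x. x \<in> set ys"] by blast
  have av: "c' \<notin> set xs" "c \<notin> set ys" "distinct (c' # ys)"
    using l pc by (auto simp: leg_def doubleton_eq_iff)
  define q where "q = last (c # as)"
  have "{q, x} \<in> pedges (c # xs)"
    using pedges_append[of "c # as" "x # bs"] by (simp add: x(1) q_def)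
  then have "{q, x} \<in> E" using l(1) by (auto simp: leg_def)
  then have qx: "{q, x} \<in> pedges (c' # ys)" using l(2) x(2) by (auto simp: leg_def)
  then have q: "q \<in> set (c' # ys)" using Union_pedges[of "c' # ys"] by auto
  show False
  proof (cases "as = []")
    case True
    then have "q = c" by (simp add: q_def)
    then have "c = c'" using q av by auto
    moreover have "x = hd ys"
      using pedges_hd_neighbour[OF av(3)] qx \<open>q = c\<close> \<open>c = c'\<close> by blast
    ultimately show False using ne x(1) True by simp
  next
    case False
    then have "q \<in> set as" by (simp add: q_def)
    then have "q \<in> set xs" "q \<notin> set ys" using x by auto
    then show False using q av by auto
  qed
qed

text \<open>The two centres and the legs form a set closed under adjacency, which by connectedness
  is everything. Passing the legs as a set of pairs lets one statement serve any number of
  legs.\<close>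

lemma legs_cover:
  assumes T: "tree_graph V E" and uv: "{u, v} \<in> E"
    and L: "\<And>c xs. (c, xs) \<in> L \<Longrightarrow> c \<in> {u, v} \<and> (\<exists>p. leg E p c xs)"
    and N: "\<And>c y. c \<in> {u, v} \<Longrightarrow> {c, y} \<in> E \<Longrightarrow> y \<in> {u, v} \<or> (\<exists>xs. (c, xs) \<in> L \<and> y \<in> set xs)"
  shows "V = {u, v} \<union> (\<Union>(c, xs)\<in>L. set xs)"
    and "E = insert {u, v} (\<Union>(c, xs)\<in>L. pedges (c # xs))"
proof -
  let ?W = "{u, v} \<union> (\<Union>(c, xs)\<in>L. set xs)"
  have EV: "\<And>e. e \<in> E \<Longrightarrow> \<exists>x\<in>V. \<exists>y\<in>V. x \<noteq> y \<and> e = {x, y}"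
    and con: "\<And>x y. x \<in> V \<Longrightarrow> y \<in> V \<Longrightarrow> (x, y) \<in> {(a, b). {a, b} \<in> E}\<^sup>*"
    using T by (auto simp: tree_graph_def simple_graph_def connected_graph_def)
  have legE: "e \<in> pedges (c # xs)" if "(c, xs) \<in> L" "e \<in> E" "x \<in> e" "x \<in> set xs" for c xs e x
    using L[OF that(1)] that(2-4) by (auto simp: leg_def)
  have closed: "y \<in> ?W" if "{x, y} \<in> E" "x \<in> ?W" for x y
  proof (cases "x \<in> {u, v}")
    case True
    from N[OF this that(1)] show ?thesis by auto
  next
    case False
    with that(2) obtain c xs where cx: "(c, xs) \<in> L" "x \<in> set xs" by auto
    from legE[OF cx(1) that(1) _ cx(2)] have "{x, y} \<in> pedges (c # xs)" by simp
    then have "y \<in> set (c # xs)" using Union_pedges[of "c # xs"] by auto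
    with cx L show ?thesis by fastforce
  qed
  have u: "u \<in> V" using EV[OF uv] by (auto simp: doubleton_eq_iff)
  show V: "V = ?W"
  proof
    show "V \<subseteq> ?W"
    proof
      fix y assume "y \<in> V"
      from con[OF u this] show "y \<in> ?W"
        by induct (use closed in auto)
    qed
    have "x \<in> V" if "(c, xs) \<in> L" "x \<in> set xs" for c xs x
    proof -
      from that(2) obtain ys zs where xs: "xs = ys @ x # zs" by (auto dest: split_list)
      have "{last (c # ys), x} \<in> pedges (c # xs)"
        using pedges_append[of "c # ys" "x # zs"] by (simp add: xs)
      then have "{last (c # ys), x} \<in> E" using L[OF that(1)] by (auto simp: leg_def)
      from EV[OF this] show ?thesis by (auto simp: doubleton_eq_iff)
    qed
    moreover have "v \<in> V" using EV[OF uv] by (auto simp: doubleton_eq_iff)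
    ultimately show "?W \<subseteq> V" using u by auto
  qed
  show "E = insert {u, v} (\<Union>(c, xs)\<in>L. pedges (c # xs))"
  proof
    show "E \<subseteq> insert {u, v} (\<Union>(c, xs)\<in>L. pedges (c # xs))"
    proof
      fix e assume e: "e \<in> E"
      show "e \<in> insert {u, v} (\<Union>(c, xs)\<in>L. pedges (c # xs))"
      proof (cases "e \<subseteq> {u, v}")
        case True
        with EV[OF e] have "e = {u, v}" by auto
        then show ?thesis by simp
      next
        case False
        with EV[OF e] V obtain x c xs where "x \<in> e" "(c, xs) \<in> L" "x \<in> set xs" by blast
        with legE e show ?thesis by blast
      qed
    qed
    show "insert {u, v} (\<Union>(c, xs)\<in>L. pedges (c # xs)) \<subseteq> E"
      using L uv by (fastforce simp: leg_def)
  qed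
qed

section \<open>Decomposing the two types of trees into legs\<close>

lemma vertex_degree_neighbours:
  assumes "simple_graph V E"
  shows "vertex_degree E x = card {y. {x, y} \<in> E}" "finite {y. {x, y} \<in> E}" "x \<notin> {y. {x, y} \<in> E}"
proof -
  have EV: "\<And>e. e \<in> E \<Longrightarrow> \<exists>x\<in>V. \<exists>y\<in>V. x \<noteq> y \<and> e = {x, y}" and fin: "finite V"
    using assms by (auto simp: simple_graph_def)
  have "{e \<in> E. x \<in> e} = (\<lambda>y. {x, y}) ` {y. {x, y} \<in> E}"
  proof
    show "{e \<in> E. x \<in> e} \<subseteq> (\<lambda>y. {x, y}) ` {y. {x, y} \<in> E}"
    proof
      fix e assume e: "e \<in> {e \<in> E. x \<in> e}"
      then obtain a b where "e = {a, b}" using EV by blast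
      with e have "e = {x, a} \<or> e = {x, b}" by auto
      with e show "e \<in> (\<lambda>y. {x, y}) ` {y. {x, y} \<in> E}" by auto
    qed
  qed auto
  moreover have "inj_on (\<lambda>y. {x, y}) {y. {x, y} \<in> E}"
    by (auto simp: inj_on_def doubleton_eq_iff)
  ultimately show "vertex_degree E x = card {y. {x, y} \<in> E}"
    by (simp add: vertex_degree_def card_image)
  have "{y. {x, y} \<in> E} \<subseteq> V" using EV by (fastforce simp: doubleton_eq_iff)
  then show "finite {y. {x, y} \<in> E}" using fin finite_subset by blast
  show "x \<notin> {y. {x, y} \<in> E}" using EV[of "{x}"] by auto
qed

text \<open>Any neighbour of the vertex \<open>u\<close> of degree 3 may serve as \<open>v\<close>.
  The other two neighbours start legs at \<open>u\<close>, and \<open>v\<close>, of degree at most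
  2, starts at most one leg of its own.\<close>

lemma first_type_legs:
  assumes "three_star_like_first V E"
  obtains u v as bs cs where "as \<noteq> []" "bs \<noteq> []" "distinct (u # v # as @ bs @ cs)"
    "set (u # v # as @ bs @ cs) = V"
    "E = {{u, v}, {u, hd as}, {u, hd bs}} \<union> pedges as \<union> pedges bs \<union> pedges (v # cs)"
proof -
  have T: "tree_graph V E" and G: "simple_graph V E" and acyc: "\<nexists>c. graph_cycle E c"
    and d4: "\<And>w. w \<in> V \<Longrightarrow> \<not> vertex_degree E w \<ge> 4"
    and "card {w \<in> V. vertex_degree E w = 3} = 1"
    using assms by (auto simp: three_star_like_first_def tree_graph_def)
  then obtain u where u: "{w \<in> V. vertex_degree E w = 3} = {u}" by (meson card_1_singletonE)
  note nb = vertex_degree_neighbours[OF G]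
  have deg: "vertex_degree E w \<le> 2" if "w \<in> V" "w \<noteq> u" for w
    using d4[OF that(1)] u that by (cases "vertex_degree E w = 3") auto
  have "card {y. {u, y} \<in> E} = 3" using u nb(1) by auto
  then obtain v a b where N: "{y. {u, y} \<in> E} = {v, a, b}" "v \<noteq> a" "v \<noteq> b" "a \<noteq> b"
    by (auto simp: card_3_iff)
  have e: "{u, v} \<in> E" "{u, a} \<in> E" "{u, b} \<in> E" "{v, u} \<in> E"
    using N(1) by (auto simp: insert_commute)
  have u': "u \<notin> {v, a, b}" using nb(3)[of u] N(1) by simp
  have vV: "v \<in> V" using e(1) G u' by (auto simp: simple_graph_def doubleton_eq_iff)
  obtain as where as: "leg E v u as" "hd as = a"
    using leg_exists[OF G acyc e(4) e(2) N(2)[symmetric]] deg by (metis insertCI)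
  obtain bs where bs: "leg E v u bs" "hd bs = b"
    using leg_exists[OF G acyc e(4) e(3) N(3)[symmetric]] deg by (metis insertCI)
  have ab: "set as \<inter> set bs = {}" by (rule leg_disjoint[OF as(1) bs(1)]) (use as bs N in auto)
  have l: "as \<noteq> []" "bs \<noteq> []" "distinct (v # u # as)" "distinct (v # u # bs)"
    using as bs by (auto simp: leg_def)
  have Nu: "y \<in> {u, v} \<or> y \<in> set as \<or> y \<in> set bs" if "{u, y} \<in> E" for y
  proof -
    have "y \<in> {v, a, b}" using that N(1) by blast
    moreover have "a \<in> set as" "b \<in> set bs" using l as(2) bs(2) by auto
    ultimately show ?thesis by blast
  qed
  have "vertex_degree E v \<le> 2" using deg[OF vV] u' by blast
  then have cv: "card ({y. {v, y} \<in> E} - {u}) \<le> 1"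
    using nb(1)[of v] nb(2)[of v] e(4) by (simp add: card_Diff_singleton)
  show thesis
  proof (cases "{y. {v, y} \<in> E} - {u} = {}")
    case True
    \<comment> \<open>A leg is nonempty, so when \<open>v\<close> is a leaf it contributes none and
      \<open>cs\<close> becomes the empty list.\<close>
    let ?L = "{(u, as), (u, bs)}"
    have cov: "V = {u, v} \<union> (\<Union>(c, xs)\<in>?L. set xs)"
      "E = insert {u, v} (\<Union>(c, xs)\<in>?L. pedges (c # xs))"
      by (rule legs_cover[OF T e(1)]; use as bs Nu True in blast)+
    show thesis
      by (rule that[of as bs u v "[]"])
        (use l ab in \<open>auto simp: cov pedges_Cons simp del: pedges.simps(1)\<close>)
  next
    case False
    then obtain c where "c \<in> {y. {v, y} \<in> E} - {u}" by blast
    moreover have "y = c" if "y \<in> {y. {v, y} \<in> E} - {u}" for y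
      using cv that calculation nb(2)[of v] card_le_Suc0_iff_eq[of "{y. {v, y} \<in> E} - {u}"]
      by simp
    ultimately have c: "{v, c} \<in> E" "c \<noteq> u" "\<And>y. {v, y} \<in> E \<Longrightarrow> y = u \<or> y = c" by blast+
    obtain cs where cs: "leg E u v cs" "hd cs = c"
      using leg_exists[OF G acyc e(1) c(1,2)] deg by (metis insertCI)
    have ac: "set as \<inter> set cs = {}" by (rule leg_disjoint[OF as(1) cs(1)]) (use u' in auto)
    have bc: "set bs \<inter> set cs = {}" by (rule leg_disjoint[OF bs(1) cs(1)]) (use u' in auto)
    have lc: "cs \<noteq> []" "distinct (u # v # cs)" using cs by (auto simp: leg_def)
    have Nv: "y \<in> {u, v} \<or> y \<in> set cs" if "{v, y} \<in> E" for y
      using c(3)[OF that] lc(1) cs(2) by auto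
    let ?L = "{(u, as), (u, bs), (v, cs)}"
    have cov: "V = {u, v} \<union> (\<Union>(c, xs)\<in>?L. set xs)"
      "E = insert {u, v} (\<Union>(c, xs)\<in>?L. pedges (c # xs))"
      by (rule legs_cover[OF T e(1)]; use as bs cs Nu Nv in blast)+
    show thesis
      by (rule that[of as bs u v cs])
        (use l lc ab ac bc in \<open>auto simp: cov pedges_Cons simp del: pedges.simps(1)\<close>)
  qed
qed

lemma second_type_legs:
  assumes "three_star_like_second V E"
  obtains u v as bs cs ds where "as \<noteq> []" "bs \<noteq> []" "cs \<noteq> []" "ds \<noteq> []"
    "distinct (u # v # as @ bs @ cs @ ds)" "set (u # v # as @ bs @ cs @ ds) = V"
    "E = {{u, v}, {u, hd as}, {u, hd bs}, {v, hd cs}, {v, hd ds}}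
      \<union> pedges as \<union> pedges bs \<union> pedges cs \<union> pedges ds"
proof -
  obtain u v where T: "tree_graph V E" and G: "simple_graph V E" and acyc: "\<nexists>c. graph_cycle E c"
    and d4: "\<And>w. w \<in> V \<Longrightarrow> \<not> vertex_degree E w \<ge> 4"
    and uv: "u \<noteq> v" "{w \<in> V. vertex_degree E w = 3} = {u, v}" and e: "{u, v} \<in> E" "{v, u} \<in> E"
    using assms by (auto simp: three_star_like_second_def tree_graph_def insert_commute)
  note nb = vertex_degree_neighbours[OF G]
  have deg: "vertex_degree E w \<le> 2" if "w \<in> V" "w \<notin> {u, v}" for w
    using d4[OF that(1)] uv(2) that by (cases "vertex_degree E w = 3") auto
  \<comment> \<open>Stated for both orientations of the central edge: at either end two neighbours
    remain besides the opposite end, and they start the legs.\<close>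
  have pair: "\<exists>a b. {y. {x, y} \<in> E} = {z, a, b} \<and> a \<notin> {x, z} \<and> b \<notin> {x, z} \<and> a \<noteq> b"
    if "vertex_degree E x = 3" "{x, z} \<in> E" for x z
  proof -
    let ?N = "{y. {x, y} \<in> E}"
    have "card (?N - {z}) = 2" using that nb(1,2)[of x] by (simp add: card_Diff_singleton)
    then obtain a b where ab: "?N - {z} = {a, b}" "a \<noteq> b" by (auto simp: card_2_iff)
    then have "?N = {z, a, b}" using that(2) by blast
    moreover have "a \<notin> {x, z}" "b \<notin> {x, z}" using ab nb(3)[of x] by blast+
    ultimately show ?thesis using ab(2) by blast
  qed
  have d3: "vertex_degree E u = 3" "vertex_degree E v = 3" using uv(2) by blast+
  obtain a b where ab: "{y. {u, y} \<in> E} = {v, a, b}" "a \<notin> {u, v}" "b \<notin> {u, v}" "a \<noteq> b"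
    using pair[OF d3(1) e(1)] by blast
  obtain c d where cd: "{y. {v, y} \<in> E} = {u, c, d}" "c \<notin> {v, u}" "d \<notin> {v, u}" "c \<noteq> d"
    using pair[OF d3(2) e(2)] by blast
  have E': "{u, a} \<in> E" "{u, b} \<in> E" "{v, c} \<in> E" "{v, d} \<in> E" using ab(1) cd(1) by blast+
  have deg': "vertex_degree E w \<le> 2" if "w \<in> V" "w \<notin> {v, u}" for w using deg that by blast
  obtain as where as: "leg E v u as" "hd as = a"
    using leg_exists[OF G acyc e(2) E'(1) _ deg'] ab by blast
  obtain bs where bs: "leg E v u bs" "hd bs = b"
    using leg_exists[OF G acyc e(2) E'(2) _ deg'] ab by blast
  obtain cs where cs: "leg E u v cs" "hd cs = c"
    using leg_exists[OF G acyc e(1) E'(3) _ deg] cd by blast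
  obtain ds where ds: "leg E u v ds" "hd ds = d"
    using leg_exists[OF G acyc e(1) E'(4) _ deg] cd by blast
  have l: "as \<noteq> []" "bs \<noteq> []" "cs \<noteq> []" "ds \<noteq> []" "distinct (v # u # as)" "distinct (v # u # bs)"
    "distinct (u # v # cs)" "distinct (u # v # ds)"
    using as bs cs ds by (auto simp: leg_def)
  have vu: "{v, u} = {u, v}" "{v, u} = {v, u}" "{u, v} = {u, v}" by auto
  note D = leg_disjoint[OF as(1) bs(1) vu(2)] leg_disjoint[OF as(1) cs(1) vu(1)]
    leg_disjoint[OF as(1) ds(1) vu(1)] leg_disjoint[OF bs(1) cs(1) vu(1)]
    leg_disjoint[OF bs(1) ds(1) vu(1)] leg_disjoint[OF cs(1) ds(1) vu(3)]
  have disj: "set as \<inter> set bs = {}" "set as \<inter> set cs = {}" "set as \<inter> set ds = {}"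
    "set bs \<inter> set cs = {}" "set bs \<inter> set ds = {}" "set cs \<inter> set ds = {}"
    using D as(2) bs(2) cs(2) ds(2) ab(4) cd(4) uv(1) by auto
  have hd: "a \<in> set as" "b \<in> set bs" "c \<in> set cs" "d \<in> set ds"
    using l as(2) bs(2) cs(2) ds(2) by auto
  have Nu: "y \<in> {u, v} \<or> y \<in> set as \<or> y \<in> set bs" if "{u, y} \<in> E" for y
    using that ab(1) hd by blast
  have Nv: "y \<in> {u, v} \<or> y \<in> set cs \<or> y \<in> set ds" if "{v, y} \<in> E" for y
    using that cd(1) hd by blast
  let ?L = "{(u, as), (u, bs), (v, cs), (v, ds)}"
  have cov: "V = {u, v} \<union> (\<Union>(c, xs)\<in>?L. set xs)"
    "E = insert {u, v} (\<Union>(c, xs)\<in>?L. pedges (c # xs))"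
    by (rule legs_cover[OF T e(1)]; use as bs cs ds Nu Nv in blast)+
  show thesis
    by (rule that[of as bs cs ds u v])
      (use l disj in \<open>auto simp: cov pedges_Cons simp del: pedges.simps(1)\<close>)
qed

lemma fps_eq_divideI:
  fixes f g :: "rat fps"
  assumes "f * (1 - fps_X) ^ k = g"
  shows "f = g / (1 - fps_X) ^ k"
proof -
  have "fps_nth (1 - fps_X :: rat fps) 0 \<noteq> 0" by simp
  then have "(1 - fps_X :: rat fps) \<noteq> 0" by (metis fps_zero_nth)
  then show ?thesis using assms by (metis nonzero_mult_div_cancel_right power_not_zero)
qed

theorem corollary2p7:
  fixes n :: nat and E :: "nat set set"
  shows "(three_star_like_first {1..n} E \<longrightarrow>
      n > 3 \<and>
      quot_hilbert_series n (binomial_edge_ideal n E :: 'k::field mpol set) =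
        (1 + 2 * fps_X - 2 * fps_X ^ 3) * (1 + fps_X) ^ (n - 4) / (1 - fps_X) ^ (n + 2)) \<and>
    (three_star_like_second {1..n} E \<longrightarrow>
      n > 5 \<and>
      quot_hilbert_series n (binomial_edge_ideal n E :: 'k mpol set) =
        (1 + 4 * fps_X + 5 * fps_X ^ 2 - 3 * fps_X ^ 4) * (1 + fps_X) ^ (n - 6)
          / (1 - fps_X) ^ (n + 2))"
proof (intro conjI impI)
  have quot: "quot_hilbert_series n (binomial_edge_ideal n E :: 'k mpol set)
      = hser n (idl n (gens E :: 'k mpol set))" if "tree_graph {1..n} E"
    using that by (intro quot_hilbert_series_binomial) (auto simp: tree_graph_def simple_graph_def)
  have long: "length xs \<ge> 1" if "xs \<noteq> []" for xs :: "nat list"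
    using that by (cases xs) auto
  {
    assume G: "three_star_like_first {1..n} E"
    then obtain u v as bs cs where *: "as \<noteq> []" "bs \<noteq> []" "distinct (u # v # as @ bs @ cs)"
      "set (u # v # as @ bs @ cs) = {1..n}"
      "E = {{u, v}, {u, hd as}, {u, hd bs}} \<union> pedges as \<union> pedges bs \<union> pedges (v # cs)"
      by (rule first_type_legs)
    show "n > 3"
      using distinct_card[OF *(3), unfolded *(4)] long[OF *(1)] long[OF *(2)] by simp
    show "quot_hilbert_series n (binomial_edge_ideal n E :: 'k mpol set) =
        (1 + 2 * fps_X - 2 * fps_X ^ 3) * (1 + fps_X) ^ (n - 4) / (1 - fps_X) ^ (n + 2)"
      using hser_first_type[OF *] G quot
      by (intro fps_eq_divideI) (simp add: three_star_like_first_def)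
  next
    assume G: "three_star_like_second {1..n} E"
    then obtain u v as bs cs ds where *: "as \<noteq> []" "bs \<noteq> []" "cs \<noteq> []" "ds \<noteq> []"
      "distinct (u # v # as @ bs @ cs @ ds)" "set (u # v # as @ bs @ cs @ ds) = {1..n}"
      "E = {{u, v}, {u, hd as}, {u, hd bs}, {v, hd cs}, {v, hd ds}}
        \<union> pedges as \<union> pedges bs \<union> pedges cs \<union> pedges ds"
      by (rule second_type_legs)
    show "n > 5"
      using distinct_card[OF *(5), unfolded *(6)] long[OF *(1)] long[OF *(2)] long[OF *(3)] long[OF *(4)]
      by simp
    show "quot_hilbert_series n (binomial_edge_ideal n E :: 'k mpol set) =
        (1 + 4 * fps_X + 5 * fps_X ^ 2 - 3 * fps_X ^ 4) * (1 + fps_X) ^ (n - 6)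
          / (1 - fps_X) ^ (n + 2)"
      using hser_second_type[OF *] G quot
      by (intro fps_eq_divideI) (simp add: three_star_like_second_def)
  }
qed

end
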